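(* Let $\mathbf L$ be a finitely generated projective lattice, and suppose there is an integer $n$ with $3\le n<\omega$ such that $\mathbf L$ is elementarily equivalent to the free lattice $\mathbf F_n$. Then $\mathbf L\cong\mathbf F_n$.
   Context: A lattice $\mathbf L$ is projective if for every surjective lattice homomorphism $f:\mathbf M\to\mathbf N$ and every homomorphism $h:\mathbf L\to\mathbf N$ there is a homomorphism $g:\mathbf L\to\mathbf M$ with $h=fg$. $\mathbf F_n$ is the free lattice on $n$ generators; elementary equivalence is in the first-order language of lattices. *)

theory Defs
  imports "HOL-Algebra.Lattice"
begin

section \<open>Lattice homomorphisms\<close>

definition lattice_hom :: "'a gorder \<Rightarrow> 'b gorder \<Rightarrow> ('a \<Rightarrow> 'b) set" where
  "lattice_hom L M = {f \<in> carrier L \<rightarrow> carrier M. join_pres L M f \<and> meet_pres L M f}"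

definition lattice_isomorphic :: "'a gorder \<Rightarrow> 'b gorder \<Rightarrow> bool" where
  "lattice_isomorphic L M \<longleftrightarrow> (\<exists>f\<in>lattice_hom L M. bij_betw f (carrier L) (carrier M))"

inductive_set sublattice_generated :: "'a gorder \<Rightarrow> 'a set \<Rightarrow> 'a set"
  for L :: "'a gorder" and X :: "'a set" where
  gen: "x \<in> X \<Longrightarrow> x \<in> sublattice_generated L X"
| join: "x \<in> sublattice_generated L X \<Longrightarrow> y \<in> sublattice_generated L X
    \<Longrightarrow> x \<squnion>\<^bsub>L\<^esub> y \<in> sublattice_generated L X"
| meet: "x \<in> sublattice_generated L X \<Longrightarrow> y \<in> sublattice_generated L X
    \<Longrightarrow> x \<sqinter>\<^bsub>L\<^esub> y \<in> sublattice_generated L X"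

definition finitely_generated_lattice :: "'a gorder \<Rightarrow> bool" where
  "finitely_generated_lattice L \<longleftrightarrow>
    (\<exists>X. finite X \<and> X \<subseteq> carrier L \<and> sublattice_generated L X = carrier L)"


section \<open>Lattice terms and the first-order language of lattices\<close>

datatype (term_vars: 'x) lattice_term =
    TVar 'x
  | TJoin "'x lattice_term" "'x lattice_term"
  | TMeet "'x lattice_term" "'x lattice_term"

primrec eval_term :: "'a gorder \<Rightarrow> ('x \<Rightarrow> 'a) \<Rightarrow> 'x lattice_term \<Rightarrow> 'a" where
  "eval_term L e (TVar x) = e x"
| "eval_term L e (TJoin s t) = eval_term L e s \<squnion>\<^bsub>L\<^esub> eval_term L e t"
| "eval_term L e (TMeet s t) = eval_term L e s \<sqinter>\<^bsub>L\<^esub> eval_term L e t"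

text \<open>The signature consists of the two binary operations; the order is definable
  (\<open>x \<le> y\<close> iff \<open>x \<squnion> y = y\<close>).  The remaining connectives and the existential quantifier
  are definable from those below.\<close>

datatype lattice_formula =
    FEq "nat lattice_term" "nat lattice_term"
  | FNeg lattice_formula
  | FConj lattice_formula lattice_formula
  | FAll nat lattice_formula

primrec free_vars :: "lattice_formula \<Rightarrow> nat set" where
  "free_vars (FEq s t) = term_vars s \<union> term_vars t"
| "free_vars (FNeg \<phi>) = free_vars \<phi>"
| "free_vars (FConj \<phi> \<psi>) = free_vars \<phi> \<union> free_vars \<psi>"
| "free_vars (FAll k \<phi>) = free_vars \<phi> - {k}"

primrec satisfies :: "'a gorder \<Rightarrow> (nat \<Rightarrow> 'a) \<Rightarrow> lattice_formula \<Rightarrow> bool" where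
  "satisfies L e (FEq s t) \<longleftrightarrow> eval_term L e s = eval_term L e t"
| "satisfies L e (FNeg \<phi>) \<longleftrightarrow> \<not> satisfies L e \<phi>"
| "satisfies L e (FConj \<phi> \<psi>) \<longleftrightarrow> satisfies L e \<phi> \<and> satisfies L e \<psi>"
| "satisfies L e (FAll k \<phi>) \<longleftrightarrow> (\<forall>a\<in>carrier L. satisfies L (e(k := a)) \<phi>)"

definition models :: "'a gorder \<Rightarrow> lattice_formula \<Rightarrow> bool" where
  "models L \<phi> \<longleftrightarrow> (\<forall>e. range e \<subseteq> carrier L \<longrightarrow> satisfies L e \<phi>)"

definition elementarily_equivalent :: "'a gorder \<Rightarrow> 'b gorder \<Rightarrow> bool" where
  "elementarily_equivalent L M \<longleftrightarrow>
    (\<forall>\<phi>. free_vars \<phi> = {} \<longrightarrow> (models L \<phi> \<longleftrightarrow> models M \<phi>))"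


section \<open>Free lattices\<close>

definition terms_over :: "'x set \<Rightarrow> 'x lattice_term set" where
  "terms_over X = {t. term_vars t \<subseteq> X}"

text \<open>Provable equality of terms over \<open>X\<close> from the lattice identities (idempotence
  follows from absorption).\<close>

inductive_set lattice_cong :: "'x set \<Rightarrow> ('x lattice_term \<times> 'x lattice_term) set"
  for X :: "'x set" where
  refl: "s \<in> terms_over X \<Longrightarrow> (s, s) \<in> lattice_cong X"
| sym: "(s, t) \<in> lattice_cong X \<Longrightarrow> (t, s) \<in> lattice_cong X"
| trans: "(s, t) \<in> lattice_cong X \<Longrightarrow> (t, u) \<in> lattice_cong X \<Longrightarrow> (s, u) \<in> lattice_cong X"
| join_cong: "(s, s') \<in> lattice_cong X \<Longrightarrow> (t, t') \<in> lattice_cong X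
    \<Longrightarrow> (TJoin s t, TJoin s' t') \<in> lattice_cong X"
| meet_cong: "(s, s') \<in> lattice_cong X \<Longrightarrow> (t, t') \<in> lattice_cong X
    \<Longrightarrow> (TMeet s t, TMeet s' t') \<in> lattice_cong X"
| join_comm: "s \<in> terms_over X \<Longrightarrow> t \<in> terms_over X
    \<Longrightarrow> (TJoin s t, TJoin t s) \<in> lattice_cong X"
| meet_comm: "s \<in> terms_over X \<Longrightarrow> t \<in> terms_over X
    \<Longrightarrow> (TMeet s t, TMeet t s) \<in> lattice_cong X"
| join_assoc: "s \<in> terms_over X \<Longrightarrow> t \<in> terms_over X \<Longrightarrow> u \<in> terms_over X
    \<Longrightarrow> (TJoin (TJoin s t) u, TJoin s (TJoin t u)) \<in> lattice_cong X"
| meet_assoc: "s \<in> terms_over X \<Longrightarrow> t \<in> terms_over X \<Longrightarrow> u \<in> terms_over X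
    \<Longrightarrow> (TMeet (TMeet s t) u, TMeet s (TMeet t u)) \<in> lattice_cong X"
| join_absorb: "s \<in> terms_over X \<Longrightarrow> t \<in> terms_over X
    \<Longrightarrow> (TJoin s (TMeet s t), s) \<in> lattice_cong X"
| meet_absorb: "s \<in> terms_over X \<Longrightarrow> t \<in> terms_over X
    \<Longrightarrow> (TMeet s (TJoin s t), s) \<in> lattice_cong X"

definition free_lattice :: "'x set \<Rightarrow> 'x lattice_term set gorder" where
  "free_lattice X =
    \<lparr>carrier = terms_over X // lattice_cong X,
     eq = (=),
     le = (\<lambda>A B. \<exists>s\<in>A. \<exists>t\<in>B. (TJoin s t, t) \<in> lattice_cong X)\<rparr>"

definition free_gen :: "'x set \<Rightarrow> 'x \<Rightarrow> 'x lattice_term set" where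
  "free_gen X x = lattice_cong X `` {TVar x}"

abbreviation free_lattice_on :: "nat \<Rightarrow> nat lattice_term set gorder" where
  "free_lattice_on n \<equiv> free_lattice {..<n}"

lemma terms_over_simps [simp]:
  "TVar x \<in> terms_over X \<longleftrightarrow> x \<in> X"
  "TJoin s t \<in> terms_over X \<longleftrightarrow> s \<in> terms_over X \<and> t \<in> terms_over X"
  "TMeet s t \<in> terms_over X \<longleftrightarrow> s \<in> terms_over X \<and> t \<in> terms_over X"
  by (auto simp: terms_over_def)

lemma lattice_cong_terms:
  "(s, t) \<in> lattice_cong X \<Longrightarrow> s \<in> terms_over X \<and> t \<in> terms_over X"
  by (induction rule: lattice_cong.induct) auto

lemma equiv_lattice_cong: "equiv (terms_over X) (lattice_cong X)"
proof (rule equivI)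
  show "lattice_cong X \<subseteq> terms_over X \<times> terms_over X"
    by (auto dest: lattice_cong_terms)
  show "refl_on (terms_over X) (lattice_cong X)"
    by (rule refl_onI) (auto intro: lattice_cong.refl)
  show "sym_on UNIV (lattice_cong X)" by (auto intro!: symI intro: lattice_cong.sym)
  show "trans_on UNIV (lattice_cong X)" by (auto intro!: transI intro: lattice_cong.trans)
qed

lemma lattice_cong_join_idem:
  assumes "s \<in> terms_over X" shows "(TJoin s s, s) \<in> lattice_cong X"
proof -
  have "(TMeet s (TJoin s s), s) \<in> lattice_cong X" using assms by (simp add: lattice_cong.meet_absorb)
  then have "(TJoin s (TMeet s (TJoin s s)), TJoin s s) \<in> lattice_cong X"
    using assms by (auto intro: lattice_cong.join_cong lattice_cong.refl)
  moreover have "(TJoin s (TMeet s (TJoin s s)), s) \<in> lattice_cong X"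
    using assms by (simp add: lattice_cong.join_absorb)
  ultimately show ?thesis by (meson lattice_cong.sym lattice_cong.trans)
qed

lemma lattice_cong_le_iff:
  assumes "s \<in> terms_over X" "t \<in> terms_over X"
  shows "(TJoin s t, t) \<in> lattice_cong X \<longleftrightarrow> (TMeet s t, s) \<in> lattice_cong X"
proof
  assume a: "(TJoin s t, t) \<in> lattice_cong X"
  have "(TMeet s (TJoin s t), TMeet s t) \<in> lattice_cong X"
    using a assms by (auto intro: lattice_cong.meet_cong lattice_cong.refl)
  moreover have "(TMeet s (TJoin s t), s) \<in> lattice_cong X"
    using assms by (auto intro: lattice_cong.meet_absorb)
  ultimately show "(TMeet s t, s) \<in> lattice_cong X"
    by (meson lattice_cong.sym lattice_cong.trans)
next
  assume a: "(TMeet s t, s) \<in> lattice_cong X"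
  have 1: "(TJoin t (TMeet t s), t) \<in> lattice_cong X"
    using assms by (auto intro: lattice_cong.join_absorb)
  have "(TMeet t s, s) \<in> lattice_cong X"
    using a assms by (meson lattice_cong.meet_comm lattice_cong.trans)
  then have "(TJoin t (TMeet t s), TJoin t s) \<in> lattice_cong X"
    using assms by (auto intro: lattice_cong.join_cong lattice_cong.refl)
  moreover have "(TJoin s t, TJoin t s) \<in> lattice_cong X"
    using assms by (auto intro: lattice_cong.join_comm)
  ultimately show "(TJoin s t, t) \<in> lattice_cong X"
    using 1 by (meson lattice_cong.sym lattice_cong.trans)
qed

abbreviation (input) free_class :: "'x set \<Rightarrow> 'x lattice_term \<Rightarrow> 'x lattice_term set" where
  "free_class X t \<equiv> lattice_cong X `` {t}"

lemma free_class_eq_iff: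
  "s \<in> terms_over X \<Longrightarrow> t \<in> terms_over X \<Longrightarrow>
    free_class X s = free_class X t \<longleftrightarrow> (s, t) \<in> lattice_cong X"
  by (rule eq_equiv_class_iff[OF equiv_lattice_cong])

lemma carrier_free_latticeE:
  assumes "A \<in> carrier (free_lattice X)"
  obtains t where "t \<in> terms_over X" "A = free_class X t"
  using assms by (auto simp: free_lattice_def elim: quotientE)

lemma free_class_carrier: "t \<in> terms_over X \<Longrightarrow> free_class X t \<in> carrier (free_lattice X)"
  by (auto simp: free_lattice_def intro: quotientI)

lemma free_lattice_le:
  assumes s: "s \<in> terms_over X" and t: "t \<in> terms_over X"
  shows "free_class X s \<sqsubseteq>\<^bsub>free_lattice X\<^esub> free_class X t \<longleftrightarrow> (TJoin s t, t) \<in> lattice_cong X"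
proof
  assume "free_class X s \<sqsubseteq>\<^bsub>free_lattice X\<^esub> free_class X t"
  then obtain s' t' where *: "(s, s') \<in> lattice_cong X" "(t, t') \<in> lattice_cong X"
     "(TJoin s' t', t') \<in> lattice_cong X"
    by (auto simp: free_lattice_def)
  then have "(TJoin s t, TJoin s' t') \<in> lattice_cong X" by (blast intro: lattice_cong.join_cong)
  with * show "(TJoin s t, t) \<in> lattice_cong X"
    by (meson lattice_cong.sym lattice_cong.trans)
next
  assume "(TJoin s t, t) \<in> lattice_cong X"
  with s t show "free_class X s \<sqsubseteq>\<^bsub>free_lattice X\<^esub> free_class X t"
    by (auto simp: free_lattice_def intro: lattice_cong.refl)
qed

lemma (in lattice) join_eqI:
  assumes "x \<in> carrier L" "y \<in> carrier L" "s \<in> carrier L" "x \<sqsubseteq> s" "y \<sqsubseteq> s"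
    "\<And>z. z \<in> carrier L \<Longrightarrow> x \<sqsubseteq> z \<Longrightarrow> y \<sqsubseteq> z \<Longrightarrow> s \<sqsubseteq> z"
  shows "x \<squnion> y = s"
  using assms by (intro le_antisym join_le) (auto simp: join_left join_right)

lemma (in lattice) meet_eqI:
  assumes "x \<in> carrier L" "y \<in> carrier L" "s \<in> carrier L" "s \<sqsubseteq> x" "s \<sqsubseteq> y"
    "\<And>z. z \<in> carrier L \<Longrightarrow> z \<sqsubseteq> x \<Longrightarrow> z \<sqsubseteq> y \<Longrightarrow> z \<sqsubseteq> s"
  shows "x \<sqinter> y = s"
proof (rule le_antisym)
  show "x \<sqinter> y \<sqsubseteq> s" using assms by (simp add: meet_left meet_right)
  show "s \<sqsubseteq> x \<sqinter> y" using assms by (intro meet_le) auto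
qed (use assms in auto)

context
  fixes X :: "'x set" and s t :: "'x lattice_term"
  assumes s: "s \<in> terms_over X" and t: "t \<in> terms_over X"
begin

lemma free_join_upper1: "free_class X s \<sqsubseteq>\<^bsub>free_lattice X\<^esub> free_class X (TJoin s t)"
proof -
  have "(TMeet s (TJoin s t), s) \<in> lattice_cong X"
    using s t by (auto intro: lattice_cong.meet_absorb)
  then show ?thesis using s t by (simp add: free_lattice_le lattice_cong_le_iff)
qed

lemma free_join_least:
  assumes u: "u \<in> terms_over X" "free_class X s \<sqsubseteq>\<^bsub>free_lattice X\<^esub> free_class X u"
    "free_class X t \<sqsubseteq>\<^bsub>free_lattice X\<^esub> free_class X u"
  shows "free_class X (TJoin s t) \<sqsubseteq>\<^bsub>free_lattice X\<^esub> free_class X u"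
proof -
  have 1: "(TJoin s u, u) \<in> lattice_cong X" and 2: "(TJoin t u, u) \<in> lattice_cong X"
    using u s t by (auto simp: free_lattice_le)
  have "(TJoin (TJoin s t) u, TJoin s (TJoin t u)) \<in> lattice_cong X"
    using u s t by (auto intro: lattice_cong.join_assoc)
  moreover have "(TJoin s (TJoin t u), TJoin s u) \<in> lattice_cong X"
    using 2 s by (auto intro: lattice_cong.join_cong lattice_cong.refl)
  ultimately show ?thesis
    using 1 s t u by (simp add: free_lattice_le) (meson lattice_cong.trans)
qed

lemma free_meet_lower1: "free_class X (TMeet s t) \<sqsubseteq>\<^bsub>free_lattice X\<^esub> free_class X s"
proof -
  have "(TJoin s (TMeet s t), s) \<in> lattice_cong X"
    using s t by (auto intro: lattice_cong.join_absorb)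
  moreover have "(TJoin (TMeet s t) s, TJoin s (TMeet s t)) \<in> lattice_cong X"
    using s t by (auto intro: lattice_cong.join_comm)
  ultimately show ?thesis using s t
    by (simp add: free_lattice_le) (meson lattice_cong.trans)
qed

lemma free_meet_greatest:
  assumes u: "u \<in> terms_over X" "free_class X u \<sqsubseteq>\<^bsub>free_lattice X\<^esub> free_class X s"
    "free_class X u \<sqsubseteq>\<^bsub>free_lattice X\<^esub> free_class X t"
  shows "free_class X u \<sqsubseteq>\<^bsub>free_lattice X\<^esub> free_class X (TMeet s t)"
proof -
  have 1: "(TMeet u s, u) \<in> lattice_cong X" and 2: "(TMeet u t, u) \<in> lattice_cong X"
    using u s t by (auto simp: free_lattice_le lattice_cong_le_iff)
  have "(TMeet (TMeet u s) t, TMeet u (TMeet s t)) \<in> lattice_cong X"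
    using u s t by (auto intro: lattice_cong.meet_assoc)
  moreover have "(TMeet (TMeet u s) t, TMeet u t) \<in> lattice_cong X"
    using 1 t by (auto intro: lattice_cong.meet_cong lattice_cong.refl)
  ultimately have "(TMeet u (TMeet s t), u) \<in> lattice_cong X"
    using 2 by (meson lattice_cong.sym lattice_cong.trans)
  then show ?thesis
    using s t u by (simp add: free_lattice_le lattice_cong_le_iff)
qed

lemma free_class_join_comm: "free_class X (TJoin s t) = free_class X (TJoin t s)"
  using s t by (subst free_class_eq_iff) (auto intro: lattice_cong.join_comm)

lemma free_class_meet_comm: "free_class X (TMeet s t) = free_class X (TMeet t s)"
  using s t by (subst free_class_eq_iff) (auto intro: lattice_cong.meet_comm)

end

lemma free_lattice_lattice: "lattice (free_lattice X)"
proof -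
  let ?F = "free_lattice X"
  interpret partial_order ?F
  proof unfold_locales
    show "(.=\<^bsub>?F\<^esub>) = (=)" by (simp add: free_lattice_def)
    fix A assume "A \<in> carrier ?F"
    then show "A \<sqsubseteq>\<^bsub>?F\<^esub> A"
      by (auto elim!: carrier_free_latticeE simp: free_lattice_le lattice_cong_join_idem)
  next
    fix A B assume "A \<sqsubseteq>\<^bsub>?F\<^esub> B" "B \<sqsubseteq>\<^bsub>?F\<^esub> A" "A \<in> carrier ?F" "B \<in> carrier ?F"
    then obtain s t where st: "s \<in> terms_over X" "t \<in> terms_over X"
      "A = free_class X s" "B = free_class X t"
      "(TJoin s t, t) \<in> lattice_cong X" "(TJoin t s, s) \<in> lattice_cong X"
      by (auto elim!: carrier_free_latticeE simp: free_lattice_le)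
    then have "(s, t) \<in> lattice_cong X"
      by (meson lattice_cong.sym lattice_cong.trans lattice_cong.join_comm)
    with st show "A .=\<^bsub>?F\<^esub> B" by (simp add: free_lattice_def free_class_eq_iff)
  next
    fix A B C assume le: "A \<sqsubseteq>\<^bsub>?F\<^esub> B" "B \<sqsubseteq>\<^bsub>?F\<^esub> C"
      and "A \<in> carrier ?F" "B \<in> carrier ?F" "C \<in> carrier ?F"
    then obtain s t u where stu: "s \<in> terms_over X" "t \<in> terms_over X" "u \<in> terms_over X"
      "A = free_class X s" "B = free_class X t" "C = free_class X u"
      by (auto elim!: carrier_free_latticeE)
    with le have 1: "(TJoin s t, t) \<in> lattice_cong X" and 2: "(TJoin t u, u) \<in> lattice_cong X"
      by (auto simp: free_lattice_le)
    have "(TJoin s u, TJoin s (TJoin t u)) \<in> lattice_cong X"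
      using stu 2 by (auto intro: lattice_cong.join_cong lattice_cong.refl lattice_cong.sym)
    moreover have "(TJoin s (TJoin t u), TJoin (TJoin s t) u) \<in> lattice_cong X"
      using stu by (auto intro: lattice_cong.join_assoc lattice_cong.sym)
    moreover have "(TJoin (TJoin s t) u, TJoin t u) \<in> lattice_cong X"
      using stu 1 by (auto intro: lattice_cong.join_cong lattice_cong.refl)
    ultimately show "A \<sqsubseteq>\<^bsub>?F\<^esub> C"
      using 2 stu by (simp add: free_lattice_le) (meson lattice_cong.trans)
  qed (auto simp: free_lattice_def)
  show ?thesis
  proof unfold_locales
    fix A B assume "A \<in> carrier ?F" "B \<in> carrier ?F"
    then obtain s t where st: "s \<in> terms_over X" "t \<in> terms_over X"
      "A = free_class X s" "B = free_class X t"
      by (auto elim!: carrier_free_latticeE)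
    have "least ?F (free_class X (TJoin s t)) (Upper ?F {A, B})"
      using st free_join_upper1[of t X s] free_join_upper1[of s X t]
        free_class_carrier[of _ X]
      by (intro least_UpperI)
        (auto simp: free_class_join_comm[of t X s] Upper_def elim!: carrier_free_latticeE
          intro!: free_join_least)
    then show "\<exists>s. least ?F s (Upper ?F {A, B})" ..
    have "greatest ?F (free_class X (TMeet s t)) (Lower ?F {A, B})"
      using st free_meet_lower1[of t X s] free_meet_lower1[of s X t]
        free_class_carrier[of _ X]
      by (intro greatest_LowerI)
        (auto simp: free_class_meet_comm[of t X s] Lower_def elim!: carrier_free_latticeE
          intro!: free_meet_greatest)
    then show "\<exists>s. greatest ?F s (Lower ?F {A, B})" ..
  qed
qed

lemma free_lattice_join:
  assumes "s \<in> terms_over X" "t \<in> terms_over X"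
  shows "free_class X s \<squnion>\<^bsub>free_lattice X\<^esub> free_class X t = free_class X (TJoin s t)"
  using assms free_join_upper1[of t X s] free_join_upper1[of s X t]
  by (intro lattice.join_eqI free_lattice_lattice free_class_carrier)
    (auto simp: free_class_join_comm[of t X s] elim!: carrier_free_latticeE intro!: free_join_least)

lemma free_lattice_meet:
  assumes "s \<in> terms_over X" "t \<in> terms_over X"
  shows "free_class X s \<sqinter>\<^bsub>free_lattice X\<^esub> free_class X t = free_class X (TMeet s t)"
  using assms free_meet_lower1[of t X s] free_meet_lower1[of s X t]
  by (intro lattice.meet_eqI free_lattice_lattice free_class_carrier)
    (auto simp: free_class_meet_comm[of t X s] elim!: carrier_free_latticeE intro!: free_meet_greatest)

lemma eval_term_closed:
  assumes "lattice L" "e \<in> X \<rightarrow> carrier L" "t \<in> terms_over X"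
  shows "eval_term L e t \<in> carrier L"
proof -
  interpret lattice L by fact
  show ?thesis using assms(2,3) by (induction t) auto
qed

lemma eval_term_cong:
  assumes "lattice L" "e \<in> X \<rightarrow> carrier L" "(s, t) \<in> lattice_cong X"
  shows "eval_term L e s = eval_term L e t"
proof -
  interpret lattice L by fact
  note cl = eval_term_closed[OF assms(1,2)]
  show ?thesis using assms(3)
  proof (induction rule: lattice_cong.induct)
    case (join_comm s t) then show ?case by (simp add: Lattice.join_comm)
  next
    case (meet_comm s t) then show ?case by (simp add: Lattice.meet_comm)
  next
    case (join_assoc s t u) then show ?case
      using weak_join_assoc[OF cl cl cl, of s t u] by (simp add: eq_is_equal)
  next
    case (meet_assoc s t u) then show ?case
      using weak_meet_assoc[OF cl cl cl, of s t u] by (simp add: eq_is_equal)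
  next
    case (join_absorb s t) then show ?case
      by (auto intro!: join_eqI simp: cl meet_left)
  next
    case (meet_absorb s t) then show ?case
      by (auto intro!: meet_eqI simp: cl join_left)
  qed auto
qed

text \<open>The universal property, for target lattices over an arbitrary type.\<close>

lemma free_lattice_universal:
  assumes L: "lattice L" and e: "e \<in> X \<rightarrow> carrier L"
  shows "\<exists>f\<in>lattice_hom (free_lattice X) L. (\<forall>x\<in>X. f (free_gen X x) = e x) \<and>
    (\<forall>g\<in>lattice_hom (free_lattice X) L. (\<forall>x\<in>X. g (free_gen X x) = e x) \<longrightarrow>
       (\<forall>A\<in>carrier (free_lattice X). g A = f A))"
proof -
  define f where "f A = eval_term L e (SOME t. t \<in> A)" for A
  have f: "f (free_class X t) = eval_term L e t" if "t \<in> terms_over X" for t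
  proof -
    have "t \<in> free_class X t" using that by (auto intro: lattice_cong.refl)
    then have "(SOME t'. t' \<in> free_class X t) \<in> free_class X t" by (rule someI)
    then show ?thesis unfolding f_def using eval_term_cong[OF L e] by fastforce
  qed
  have "f \<in> lattice_hom (free_lattice X) L"
    by (auto simp: lattice_hom_def join_pres_def meet_pres_def L free_lattice_lattice f free_lattice_join free_lattice_meet
        intro: eval_term_closed[OF L e] elim!: carrier_free_latticeE)
  moreover have "\<forall>x\<in>X. f (free_gen X x) = e x" by (simp add: free_gen_def f)
  moreover have "g A = f A"
    if g: "g \<in> lattice_hom (free_lattice X) L" "\<forall>x\<in>X. g (free_gen X x) = e x"
      and A: "A \<in> carrier (free_lattice X)" for g A
  proof -
    have "g (free_class X t) = eval_term L e t" if "t \<in> terms_over X" for t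
      using that
    proof (induction t)
      case (TVar x) then show ?case using g(2) by (simp add: free_gen_def)
    next
      case (TJoin s t)
      then show ?case using g(1)
        by (simp add: free_lattice_join[symmetric] lattice_hom_def join_pres_def free_class_carrier)
    next
      case (TMeet s t)
      then show ?case using g(1)
        by (simp add: free_lattice_meet[symmetric] lattice_hom_def meet_pres_def free_class_carrier)
    qed
    with A show ?thesis by (auto elim!: carrier_free_latticeE simp: f)
  qed
  ultimately show ?thesis by blast
qed


section \<open>Projective lattices\<close>

text \<open>HOL formulas cannot quantify over types, so \<open>M\<close> and \<open>N\<close> range over the lattices whose
  elements live in the type carrying the free lattice generated by the elements of \<open>L\<close>.  This
  is no restriction: by \<open>projective_lattice_lifting\<close> below, the lifting property then
  holds for lattices over arbitrary types.\<close>

definition projective_lattice :: "'a gorder \<Rightarrow> bool" where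
  "projective_lattice L \<longleftrightarrow>
    (\<forall>(M :: 'a lattice_term set gorder) (N :: 'a lattice_term set gorder) f h.
       lattice M \<and> lattice N \<and> f \<in> lattice_hom M N \<and> f ` carrier M = carrier N \<and>
       h \<in> lattice_hom L N \<longrightarrow>
       (\<exists>g\<in>lattice_hom L M. \<forall>x\<in>carrier L. h x = f (g x)))"

lemma lattice_hom_comp:
  "f \<in> lattice_hom L M \<Longrightarrow> g \<in> lattice_hom M N \<Longrightarrow> (\<lambda>x. g (f x)) \<in> lattice_hom L N"
  by (auto simp: lattice_hom_def join_pres_def meet_pres_def Pi_iff)

lemma lattice_copy:
  fixes L :: "'a gorder" (structure) and i :: "'a \<Rightarrow> 'b"
  assumes "lattice L" "inj i"
  shows "\<exists>N. lattice N \<and> carrier N = i ` carrier L \<and> i \<in> lattice_hom L N \<and> inv i \<in> lattice_hom N L"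
proof -
  interpret lattice L by fact
  define N :: "'b gorder" where "N = \<lparr>carrier = i ` carrier L, eq = (=), le = (\<lambda>a b. inv i a \<sqsubseteq> inv i b)\<rparr>"
  have inv: "inv i (i x) = x" for x using assms(2) by simp
  interpret N: partial_order N
    by unfold_locales (auto simp: N_def inv intro: le_trans dest: le_antisym)
  interpret N: lattice N
  proof unfold_locales
    fix a b assume "a \<in> carrier N" "b \<in> carrier N"
    then obtain x y where xy: "x \<in> carrier L" "y \<in> carrier L" "a = i x" "b = i y"
      by (auto simp: N_def)
    have "least N (i (x \<squnion> y)) (Upper N {a, b})"
      using xy by (intro least_UpperI)
        (auto simp: N_def inv Upper_def join_left join_right intro: join_le)
    then show "\<exists>s. least N s (Upper N {a, b})" ..
    have "greatest N (i (x \<sqinter> y)) (Lower N {a, b})"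
      using xy by (intro greatest_LowerI)
        (auto simp: N_def inv Lower_def meet_left meet_right intro: meet_le)
    then show "\<exists>s. greatest N s (Lower N {a, b})" ..
  qed
  have j: "i x \<squnion>\<^bsub>N\<^esub> i y = i (x \<squnion> y)" if "x \<in> carrier L" "y \<in> carrier L" for x y
    using that by (intro N.join_eqI) (auto simp: N_def inv join_left join_right intro: join_le)
  have m: "i x \<sqinter>\<^bsub>N\<^esub> i y = i (x \<sqinter> y)" if "x \<in> carrier L" "y \<in> carrier L" for x y
    using that by (intro N.meet_eqI) (auto simp: N_def inv meet_left meet_right intro: meet_le)
  have c: "carrier N = i ` carrier L" by (simp add: N_def)
  show ?thesis
    by (intro exI[of _ N] conjI N.lattice_axioms c)
      (auto simp: lattice_hom_def join_pres_def meet_pres_def assms(1) N.lattice_axioms c j m inv)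
qed

theorem projective_lattice_lifting:
  fixes L :: "'a gorder" and M :: "'m gorder" and N :: "'n gorder"
  assumes L: "lattice L" and proj: "projective_lattice L"
    and M: "lattice M" and N: "lattice N"
    and f: "f \<in> lattice_hom M N" and surj: "f ` carrier M = carrier N"
    and h: "h \<in> lattice_hom L N"
  shows "\<exists>g\<in>lattice_hom L M. \<forall>x\<in>carrier L. h x = f (g x)"
proof -
  let ?C = "carrier L" let ?F = "free_lattice ?C"
  interpret L: lattice L by fact
  define i :: "'a \<Rightarrow> 'a lattice_term set" where "i x = {TVar x}" for x
  have "inj i" by (auto simp: i_def inj_def)
  then obtain L' where L': "lattice L'" "carrier L' = i ` ?C"
    "i \<in> lattice_hom L L'" "inv i \<in> lattice_hom L' L"
    using lattice_copy[OF L] by blast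
  obtain p where p: "p \<in> lattice_hom ?F L'" "\<forall>x\<in>?C. p (free_gen ?C x) = i x"
    using free_lattice_universal[OF L'(1), of i ?C] L'(2) by auto
  have gen: "free_gen ?C x \<in> carrier ?F" if "x \<in> ?C" for x
    using that by (simp add: free_gen_def free_class_carrier)
  have "p ` carrier ?F = carrier L'"
  proof
    show "p ` carrier ?F \<subseteq> carrier L'" using p(1) by (auto simp: lattice_hom_def)
    show "carrier L' \<subseteq> p ` carrier ?F"
    proof
      fix y assume "y \<in> carrier L'"
      then obtain x where x: "x \<in> ?C" "y = i x" using L'(2) by auto
      then have "y = p (free_gen ?C x)" using p(2) by simp
      then show "y \<in> p ` carrier ?F" using gen[OF x(1)] by (rule image_eqI)
    qed
  qed
  then have "\<exists>g\<in>lattice_hom L ?F. \<forall>x\<in>?C. i x = p (g x)"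
    using p(1) L'(1,3) free_lattice_lattice
    by (intro proj[unfolded projective_lattice_def, rule_format, of ?F L' p i]) blast
  then obtain g where g: "g \<in> lattice_hom L ?F" "\<forall>x\<in>?C. i x = p (g x)" by blast
  have "\<forall>x\<in>?C. \<exists>m\<in>carrier M. f m = h x"
    using h surj by (force simp: lattice_hom_def Pi_iff)
  then obtain e where e: "\<And>x. x \<in> ?C \<Longrightarrow> e x \<in> carrier M \<and> f (e x) = h x" by metis
  obtain q where q: "q \<in> lattice_hom ?F M" "\<forall>x\<in>?C. q (free_gen ?C x) = e x"
    using free_lattice_universal[OF M, of e ?C] e by auto
  have hC: "h \<in> ?C \<rightarrow> carrier N" using h by (simp add: lattice_hom_def)
  have 1: "(\<lambda>A. f (q A)) \<in> lattice_hom ?F N" by (rule lattice_hom_comp[OF q(1) f])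
  have 2: "(\<lambda>A. h (inv i (p A))) \<in> lattice_hom ?F N"
    by (rule lattice_hom_comp[OF lattice_hom_comp[OF p(1) L'(4)] h])
  have g1: "\<forall>x\<in>?C. f (q (free_gen ?C x)) = h x" using q(2) e by simp
  have g2: "\<forall>x\<in>?C. h (inv i (p (free_gen ?C x))) = h x" using p(2) \<open>inj i\<close> by simp
  have eq: "f (q A) = h (inv i (p A))" if "A \<in> carrier ?F" for A
  proof -
    obtain r where r: "\<And>g A. g \<in> lattice_hom ?F N \<Longrightarrow> \<forall>x\<in>?C. g (free_gen ?C x) = h x
        \<Longrightarrow> A \<in> carrier ?F \<Longrightarrow> g A = r A"
      using free_lattice_universal[OF N hC] by blast
    show ?thesis using r[OF 1 g1 that] r[OF 2 g2 that] by simp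
  qed
  have "h x = f (q (g x))" if "x \<in> ?C" for x
  proof -
    have "g x \<in> carrier ?F" using g(1) that by (auto simp: lattice_hom_def)
    then have "f (q (g x)) = h (inv i (p (g x)))" by (rule eq)
    also have "\<dots> = h x" using g(2) that \<open>inj i\<close> by (metis inv_f_f)
    finally show ?thesis by simp
  qed
  moreover have "(\<lambda>x. q (g x)) \<in> lattice_hom L M" by (rule lattice_hom_comp[OF g(1) q(1)])
  ultimately show ?thesis by (intro bexI[of _ "\<lambda>x. q (g x)"] ballI)
qed

end

theory Submission
  imports Defs
begin

text \<open>In the free lattice on \<open>n\<close> generators the doubly prime elements are exactly the generators, so
  \<open>L\<close> has doubly prime elements \<open>x\<^sub>1, \<dots>, x\<^sub>n\<close>, and first-order transfer shows that distinct elements of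
  the free lattice take distinct values at them.  That they generate \<open>L\<close> is a question of
  transferring finite pieces.  Let \<open>S\<^sub>0 = \<emptyset>\<close> and let \<open>S\<^bsub>k+1\<^esub>\<close> be the set of meets of generators and of
  joins of two members of \<open>S\<^sub>k\<close>.  If every nontrivial join cover of \<open>p\<close> refines into \<open>S\<^sub>k\<close>, then
  \<open>p \<in> S\<^bsub>k+1\<^esub>\<close>; since each \<open>S\<^sub>k\<close> is given by finitely many terms, this holds in \<open>L\<close> as well.  Finally,
  \<open>L\<close> is a finitely generated sublattice of a free lattice, so Whitman's condition lets the join
  covers of its elements be refined step by step, and every element of \<open>L\<close> lies in some \<open>S\<^sub>k\<close>.\<close>

section \<open>Whitman's solution of the word problem\<close>

text \<open>The rules compare raw terms and include no transitivity, so inversion is informative: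
  variables become prime, and a meet lies below a join only if a component of one side compares with
  the whole other side (Whitman's condition).\<close>

inductive whitman_le :: "'x lattice_term \<Rightarrow> 'x lattice_term \<Rightarrow> bool" where
  var: "whitman_le (TVar x) (TVar x)"
| join_left: "whitman_le s u \<Longrightarrow> whitman_le t u \<Longrightarrow> whitman_le (TJoin s t) u"
| meet_right: "whitman_le s t \<Longrightarrow> whitman_le s u \<Longrightarrow> whitman_le s (TMeet t u)"
| join_right1: "whitman_le s t \<Longrightarrow> whitman_le s (TJoin t u)"
| join_right2: "whitman_le s u \<Longrightarrow> whitman_le s (TJoin t u)"
| meet_left1: "whitman_le s u \<Longrightarrow> whitman_le (TMeet s t) u"
| meet_left2: "whitman_le t u \<Longrightarrow> whitman_le (TMeet s t) u"

inductive_cases whitman_var_varE: "whitman_le (TVar x) (TVar y)"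
inductive_cases whitman_var_joinE: "whitman_le (TVar x) (TJoin s t)"
inductive_cases whitman_meet_varE: "whitman_le (TMeet s t) (TVar x)"
inductive_cases whitman_meet_joinE: "whitman_le (TMeet s t) (TJoin u v)"

lemma whitman_le_refl: "whitman_le s s"
  by (induction s) (auto intro: whitman_le.intros)

text \<open>Cut elimination by induction on the total size: either the last rule decomposes
  \<open>s\<close> or \<open>u\<close>, or both derivations decompose the middle term
  \<open>t\<close>, which is then replaced by one of its components.\<close>

lemma whitman_le_trans:
  "whitman_le s t \<Longrightarrow> whitman_le t u \<Longrightarrow> whitman_le s u"
proof (induction "size s + size t + size u" arbitrary: s t u rule: less_induct)
  case less
  note IH = less(1)
  have s: "whitman_le s' u" if "size s' < size s" "whitman_le s' t" for s'
    using IH[of s' t u] that less(3) by simp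
  have t: "whitman_le s u" if "size t' < size t" "whitman_le s t'" "whitman_le t' u" for t'
    using IH[of s t' u] that by simp
  have u: "whitman_le s u'" if "size u' < size u" "whitman_le t u'" for u'
    using IH[of s t u'] that less(2) by simp
  from less(2) show ?case
  proof cases
    case (var x)
    then show ?thesis using less(3) by simp
  next
    case (meet_right t1 t2)
    from less(3) show ?thesis
      by cases (use meet_right t[of t1] t[of t2] u in \<open>auto intro: whitman_le.intros\<close>)
  next
    case (join_right1 t1 t2)
    from less(3) show ?thesis
      by cases (use join_right1 t[of t1] u in \<open>auto intro: whitman_le.intros\<close>)
  next
    case (join_right2 t2 t1)
    from less(3) show ?thesis
      by cases (use join_right2 t[of t2] u in \<open>auto intro: whitman_le.intros\<close>)
  qed (use s in \<open>auto intro: whitman_le.intros\<close>)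
qed

text \<open>Each lattice identity is derivable in both directions; transitivity of the congruence is
  where cut elimination enters.\<close>

lemma lattice_cong_imp_whitman:
  "(s, t) \<in> lattice_cong X \<Longrightarrow> whitman_le s t \<and> whitman_le t s"
proof (induction rule: lattice_cong.induct)
  case (trans s t u)
  then show ?case by (blast intro: whitman_le_trans)
qed (auto intro!: whitman_le.join_left whitman_le.meet_right intro: whitman_le.intros whitman_le_refl)

lemma free_class_le_join:
  assumes "s \<in> terms_over X" "t \<in> terms_over X" "u \<in> terms_over X"
    "free_class X u \<sqsubseteq>\<^bsub>free_lattice X\<^esub> free_class X s \<or> free_class X u \<sqsubseteq>\<^bsub>free_lattice X\<^esub> free_class X t"
  shows "free_class X u \<sqsubseteq>\<^bsub>free_lattice X\<^esub> free_class X (TJoin s t)"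
proof -
  interpret lattice "free_lattice X" by (rule free_lattice_lattice)
  have st: "TJoin s t \<in> terms_over X" using assms by simp
  note c = free_class_carrier[OF assms(1)] free_class_carrier[OF assms(2)]
    free_class_carrier[OF assms(3)] free_class_carrier[OF st]
  show ?thesis
    using assms(4) free_join_upper1[OF assms(1,2)] free_join_upper1[OF assms(2,1)] c
      free_class_join_comm[OF assms(1,2)]
    by (metis le_trans)
qed

lemma free_class_meet_le:
  assumes "s \<in> terms_over X" "t \<in> terms_over X" "u \<in> terms_over X"
    "free_class X s \<sqsubseteq>\<^bsub>free_lattice X\<^esub> free_class X u \<or> free_class X t \<sqsubseteq>\<^bsub>free_lattice X\<^esub> free_class X u"
  shows "free_class X (TMeet s t) \<sqsubseteq>\<^bsub>free_lattice X\<^esub> free_class X u"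
proof -
  interpret lattice "free_lattice X" by (rule free_lattice_lattice)
  have st: "TMeet s t \<in> terms_over X" using assms by simp
  note c = free_class_carrier[OF assms(1)] free_class_carrier[OF assms(2)]
    free_class_carrier[OF assms(3)] free_class_carrier[OF st]
  show ?thesis
    using assms(4) free_meet_lower1[OF assms(1,2)] free_meet_lower1[OF assms(2,1)] c
      free_class_meet_comm[OF assms(1,2)]
    by (metis le_trans)
qed

lemma whitman_imp_free_le:
  "whitman_le s t \<Longrightarrow> s \<in> terms_over X \<Longrightarrow> t \<in> terms_over X \<Longrightarrow>
    free_class X s \<sqsubseteq>\<^bsub>free_lattice X\<^esub> free_class X t"
proof (induction rule: whitman_le.induct)
  case (var x)
  interpret lattice "free_lattice X" by (rule free_lattice_lattice)
  show ?case using var by (intro le_refl free_class_carrier)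
qed (auto intro: free_class_le_join free_class_meet_le free_join_least free_meet_greatest)

theorem free_le_iff_whitman:
  assumes "s \<in> terms_over X" "t \<in> terms_over X"
  shows "free_class X s \<sqsubseteq>\<^bsub>free_lattice X\<^esub> free_class X t \<longleftrightarrow> whitman_le s t"
proof
  assume "free_class X s \<sqsubseteq>\<^bsub>free_lattice X\<^esub> free_class X t"
  then have "(TJoin s t, t) \<in> lattice_cong X" using assms by (simp add: free_lattice_le)
  then have "whitman_le (TJoin s t) t" by (simp add: lattice_cong_imp_whitman)
  moreover have "whitman_le s (TJoin s t)" by (intro whitman_le.join_right1 whitman_le_refl)
  ultimately show "whitman_le s t" by (blast intro: whitman_le_trans)
qed (use assms in \<open>blast intro: whitman_imp_free_le\<close>)

section \<open>Doubly prime elements and generators\<close>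

context lattice
begin

lemma join_le_iff:
  assumes "x \<in> carrier L" "y \<in> carrier L" "z \<in> carrier L"
  shows "x \<squnion> y \<sqsubseteq> z \<longleftrightarrow> x \<sqsubseteq> z \<and> y \<sqsubseteq> z"
  using assms by (meson join_closed join_le join_left join_right le_trans)

lemma join_eq_right_iff:
  assumes "x \<in> carrier L" "y \<in> carrier L"
  shows "x \<squnion> y = y \<longleftrightarrow> x \<sqsubseteq> y"
  using assms by (metis join_closed join_le join_left join_right le_antisym le_refl)

end

definition doubly_prime :: "'a gorder \<Rightarrow> 'a \<Rightarrow> bool" where
  "doubly_prime L x \<longleftrightarrow> (\<forall>a\<in>carrier L. \<forall>b\<in>carrier L.
    (x \<sqsubseteq>\<^bsub>L\<^esub> a \<squnion>\<^bsub>L\<^esub> b \<longrightarrow> x \<sqsubseteq>\<^bsub>L\<^esub> a \<or> x \<sqsubseteq>\<^bsub>L\<^esub> b) \<and>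
    (a \<sqinter>\<^bsub>L\<^esub> b \<sqsubseteq>\<^bsub>L\<^esub> x \<longrightarrow> a \<sqsubseteq>\<^bsub>L\<^esub> x \<or> b \<sqsubseteq>\<^bsub>L\<^esub> x))"

text \<open>The tuple is a function on all naturals of which only the values below \<open>n\<close>
  matter, so a variable assignment can serve as the tuple.\<close>

definition doubly_prime_tuple :: "'a gorder \<Rightarrow> nat \<Rightarrow> (nat \<Rightarrow> 'a) \<Rightarrow> bool" where
  "doubly_prime_tuple L n e \<longleftrightarrow> inj_on e {..<n} \<and> (\<forall>i<n. doubly_prime L (e i))"

lemma sublattice_generated_closed:
  assumes "lattice L" "Y \<subseteq> carrier L" "u \<in> sublattice_generated L Y"
  shows "u \<in> carrier L"
proof -
  interpret lattice L by fact
  show ?thesis using assms(3) by induction (use assms(2) in auto)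
qed

text \<open>If a join is join prime, applying primality to the join itself shows that it equals one
  of its joinands; dually for meets. Descending through the generation therefore ends at a
  generator.\<close>

lemma doubly_prime_mem_generators:
  fixes L :: "'a gorder" (structure)
  assumes L: "lattice L" and Y: "Y \<subseteq> carrier L"
    and "doubly_prime L u" "u \<in> sublattice_generated L Y"
  shows "u \<in> Y"
proof -
  interpret lattice L by fact
  note cl = sublattice_generated_closed[OF L Y]
  show ?thesis using assms(4,3)
  proof induction
    case (join a b)
    note ab = cl[OF join(1)] cl[OF join(2)]
    then have "a \<squnion> b \<sqsubseteq> a \<or> a \<squnion> b \<sqsubseteq> b" using join(5) by (simp add: doubly_prime_def)
    then have "a \<squnion> b = a \<or> a \<squnion> b = b" using ab by (meson join_closed join_left join_right le_antisym)
    then show ?case using join by metis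
  next
    case (meet a b)
    note ab = cl[OF meet(1)] cl[OF meet(2)]
    then have "a \<sqsubseteq> a \<sqinter> b \<or> b \<sqsubseteq> a \<sqinter> b" using meet(5) by (simp add: doubly_prime_def)
    then have "a \<sqinter> b = a \<or> a \<sqinter> b = b" using ab by (meson meet_closed meet_left meet_right le_antisym)
    then show ?case using meet by metis
  qed
qed

section \<open>The generators of a free lattice\<close>

lemma free_gen_carrier: "x \<in> X \<Longrightarrow> free_gen X x \<in> carrier (free_lattice X)"
  by (simp add: free_gen_def free_class_carrier)

lemma free_lattice_generated:
  "sublattice_generated (free_lattice X) (free_gen X ` X) = carrier (free_lattice X)"
proof
  have "free_gen X ` X \<subseteq> carrier (free_lattice X)" by (auto simp: free_gen_carrier)
  then show "sublattice_generated (free_lattice X) (free_gen X ` X) \<subseteq> carrier (free_lattice X)"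
    using sublattice_generated_closed[OF free_lattice_lattice] by blast
  have "free_class X t \<in> sublattice_generated (free_lattice X) (free_gen X ` X)"
    if "t \<in> terms_over X" for t
    using that
  proof (induction t)
    case (TVar x)
    then show ?case unfolding free_gen_def by (auto intro: sublattice_generated.gen)
  next
    case (TJoin s t)
    then show ?case by (auto simp: free_lattice_join[symmetric] intro: sublattice_generated.join)
  next
    case (TMeet s t)
    then show ?case by (auto simp: free_lattice_meet[symmetric] intro: sublattice_generated.meet)
  qed
  then show "carrier (free_lattice X) \<subseteq> sublattice_generated (free_lattice X) (free_gen X ` X)"
    by (auto elim!: carrier_free_latticeE)
qed

lemma free_gen_inj: "inj_on (free_gen X) X"
proof (rule inj_onI)
  fix x y assume "x \<in> X" "y \<in> X" "free_gen X x = free_gen X y"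
  then have "(TVar x, TVar y) \<in> lattice_cong X" by (simp add: free_gen_def free_class_eq_iff)
  then show "x = y" by (auto dest!: lattice_cong_imp_whitman elim: whitman_var_varE)
qed

text \<open>Inversion of the Whitman rules: a variable gets below a join, or above a meet, only
  through one component.\<close>

lemma free_gen_doubly_prime:
  assumes "x \<in> X" shows "doubly_prime (free_lattice X) (free_gen X x)"
  using assms unfolding doubly_prime_def free_gen_def
  by (auto elim!: carrier_free_latticeE whitman_var_joinE whitman_meet_varE
    simp: free_lattice_join free_lattice_meet free_le_iff_whitman)

lemma free_lattice_doubly_prime_tuple: "doubly_prime_tuple (free_lattice_on n) n (free_gen {..<n})"
  by (simp add: doubly_prime_tuple_def free_gen_inj free_gen_doubly_prime)

text \<open>The \<open>n\<close> distinct entries all lie among the \<open>n\<close> generators, so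
  by counting they exhaust them.\<close>

lemma doubly_prime_tuple_free_lattice:
  assumes dp: "doubly_prime_tuple (free_lattice_on n) n e"
    and e: "e \<in> {..<n} \<rightarrow> carrier (free_lattice_on n)"
  shows "e ` {..<n} = free_gen {..<n} ` {..<n}"
proof (rule card_subset_eq)
  show "e ` {..<n} \<subseteq> free_gen {..<n} ` {..<n}"
  proof (rule image_subsetI)
    fix i assume i: "i \<in> {..<n}"
    show "e i \<in> free_gen {..<n} ` {..<n}"
    proof (rule doubly_prime_mem_generators[OF free_lattice_lattice])
      show "doubly_prime (free_lattice_on n) (e i)"
        using dp i by (simp add: doubly_prime_tuple_def)
      show "e i \<in> sublattice_generated (free_lattice_on n) (free_gen {..<n} ` {..<n})"
        using e i by (auto simp: free_lattice_generated)
    qed (auto simp: free_gen_carrier)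
  qed
  show "card (e ` {..<n}) = card (free_gen {..<n} ` {..<n})"
    using dp by (simp add: doubly_prime_tuple_def card_image free_gen_inj)
qed simp

lemma hom_eval_term:
  assumes f: "f \<in> lattice_hom L M" and e: "e \<in> X \<rightarrow> carrier L" and t: "t \<in> terms_over X"
  shows "f (eval_term L e t) = eval_term M (\<lambda>x. f (e x)) t"
proof -
  have L: "lattice L" using f by (simp add: lattice_hom_def join_pres_def)
  show ?thesis using t
    by (induction t)
      (use f in \<open>auto simp: lattice_hom_def join_pres_def meet_pres_def eval_term_closed[OF L e]\<close>)
qed

lemma eval_free_gen:
  "t \<in> terms_over X \<Longrightarrow> eval_term (free_lattice X) (free_gen X) t = free_class X t"
  by (induction t) (auto simp: free_gen_def free_lattice_join free_lattice_meet)

text \<open>The tuple enumerates the generators, possibly in another order; an endomorphism of the free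
  lattice undoes the permutation.\<close>

lemma doubly_prime_tuple_eval_inj:
  assumes dp: "doubly_prime_tuple (free_lattice_on n) n e"
    and e: "e \<in> {..<n} \<rightarrow> carrier (free_lattice_on n)"
    and st: "s \<in> terms_over {..<n}" "t \<in> terms_over {..<n}"
    and eq: "eval_term (free_lattice_on n) e s = eval_term (free_lattice_on n) e t"
  shows "(s, t) \<in> lattice_cong {..<n}"
proof -
  let ?F = "free_lattice_on n" and ?X = "{..<n}"
  \<comment> \<open>\<open>r j\<close> is the index at which \<open>e\<close> takes the
    \<open>j\<close>-th generator as its value.\<close>
  define r where "r j = the_inv_into ?X e (free_gen ?X j)" for j
  have inj: "inj_on e ?X" using dp by (simp add: doubly_prime_tuple_def)
  have gens: "e ` ?X = free_gen ?X ` ?X" by (rule doubly_prime_tuple_free_lattice[OF dp e])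
  have r: "r j \<in> ?X" if "j \<in> ?X" for j
    using that gens the_inv_into_into[OF inj, of "free_gen ?X j" ?X] by (auto simp: r_def)
  obtain q where q: "q \<in> lattice_hom ?F ?F" "\<forall>j\<in>?X. q (free_gen ?X j) = free_gen ?X (r j)"
    using free_lattice_universal[OF free_lattice_lattice, of "\<lambda>j. free_gen ?X (r j)" ?X ?X] r
    by (auto simp: free_gen_carrier Pi_iff)
  have qe: "q (e i) = free_gen ?X i" if "i \<in> ?X" for i
  proof -
    obtain j where j: "j \<in> ?X" "e i = free_gen ?X j" using gens \<open>i \<in> ?X\<close> by blast
    then have "r j = i" unfolding r_def using the_inv_into_f_f[OF inj that] by simp
    then show ?thesis using q(2) j by simp
  qed
  \<comment> \<open>So \<open>q\<close> turns the value of a term at \<open>e\<close> into the class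
    of that term, and equal values force congruent terms.\<close>
  have "q (eval_term ?F e w) = free_class ?X w" if "w \<in> terms_over ?X" for w
  proof -
    have "eval_term ?F (\<lambda>x. q (e x)) w = eval_term ?F (free_gen ?X) w"
      using that by (induction w) (auto simp: qe)
    then show ?thesis using hom_eval_term[OF q(1) e that] eval_free_gen[OF that] by simp
  qed
  then have "free_class ?X s = free_class ?X t" using eq st by metis
  then show ?thesis using st by (simp add: free_class_eq_iff)
qed

section \<open>Splitting filters\<close>

definition lattice_filter :: "'a gorder \<Rightarrow> ('a \<Rightarrow> bool) \<Rightarrow> bool" where
  "lattice_filter L R \<longleftrightarrow> (\<forall>a\<in>carrier L. \<forall>b\<in>carrier L.
    (R a \<and> a \<sqsubseteq>\<^bsub>L\<^esub> b \<longrightarrow> R b) \<and> (R a \<and> R b \<longrightarrow> R (a \<sqinter>\<^bsub>L\<^esub> b)))"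

text \<open>A quantitative form of join primality: for \<open>R c \<longleftrightarrow> p \<sqsubseteq> c\<close>, every nontrivial join cover
  of \<open>p\<close> refines to one with members in \<open>S\<close>.\<close>

definition splits :: "'a gorder \<Rightarrow> 'a set \<Rightarrow> ('a \<Rightarrow> bool) \<Rightarrow> bool" where
  "splits L S R \<longleftrightarrow> (\<forall>c\<in>carrier L. \<forall>d\<in>carrier L. R (c \<squnion>\<^bsub>L\<^esub> d) \<longrightarrow> R c \<or> R d \<or>
    (\<exists>c'\<in>S. \<exists>d'\<in>S. c' \<sqsubseteq>\<^bsub>L\<^esub> c \<and> d' \<sqsubseteq>\<^bsub>L\<^esub> d \<and> R (c' \<squnion>\<^bsub>L\<^esub> d')))"

lemma splitsE:
  assumes "splits L S R" "c \<in> carrier L" "d \<in> carrier L" "R (c \<squnion>\<^bsub>L\<^esub> d)"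
  obtains "R c" | "R d" | c' d' where "c' \<in> S" "d' \<in> S" "c' \<sqsubseteq>\<^bsub>L\<^esub> c" "d' \<sqsubseteq>\<^bsub>L\<^esub> d" "R (c' \<squnion>\<^bsub>L\<^esub> d')"
proof -
  have "R c \<or> R d \<or> (\<exists>c'\<in>S. \<exists>d'\<in>S. c' \<sqsubseteq>\<^bsub>L\<^esub> c \<and> d' \<sqsubseteq>\<^bsub>L\<^esub> d \<and> R (c' \<squnion>\<^bsub>L\<^esub> d'))"
    using assms(1)[unfolded splits_def, rule_format, OF assms(2-4)] .
  then show ?thesis using that by blast
qed

text \<open>Serves to replace a filter by the principal filter of its least element, with which it
  agrees only on the carrier.\<close>

lemma splits_cong:
  fixes L :: "'a gorder" (structure)
  assumes "lattice L" "S \<subseteq> carrier L" "splits L S R" "\<And>c. c \<in> carrier L \<Longrightarrow> R c \<longleftrightarrow> R' c"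
  shows "splits L S R'"
proof -
  interpret lattice L by fact
  show ?thesis
    unfolding splits_def
  proof (intro ballI impI)
    fix c d assume cd: "c \<in> carrier L" "d \<in> carrier L" and "R' (c \<squnion> d)"
    then have "R (c \<squnion> d)" using assms(4) by simp
    with assms(3) cd show "R' c \<or> R' d \<or> (\<exists>c'\<in>S. \<exists>d'\<in>S. c' \<sqsubseteq> c \<and> d' \<sqsubseteq> d \<and> R' (c' \<squnion> d'))"
    proof (cases rule: splitsE)
      case (3 c' d')
      then have "R' (c' \<squnion> d')" using assms(2,4) by (metis join_closed subsetD)
      with 3 show ?thesis by blast
    qed (use assms(4) cd in simp_all)
  qed
qed

lemma splits_mono: "splits L S R \<Longrightarrow> S \<subseteq> S' \<Longrightarrow> splits L S' R"
  unfolding splits_def by (meson subsetD)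

text \<open>Meets are formed of nonempty lists only, since the terms have no constant for a greatest
  element.\<close>

fun meet_list :: "'x lattice_term list \<Rightarrow> 'x lattice_term" where
  "meet_list [t] = t"
| "meet_list (t # u # ts) = TMeet t (meet_list (u # ts))"

lemma meet_list_terms_over:
  "ts \<noteq> [] \<Longrightarrow> set ts \<subseteq> terms_over X \<Longrightarrow> meet_list ts \<in> terms_over X"
  by (induction ts rule: meet_list.induct) auto

text \<open>Repetition-free lists reach every nonempty finite set of generators and joins, and they
  keep the level finite when \<open>X\<close> and \<open>T\<close> are.\<close>

definition next_level :: "'x set \<Rightarrow> 'x lattice_term set \<Rightarrow> 'x lattice_term set" where
  "next_level X T = meet_list ` {ts. ts \<noteq> [] \<and> distinct ts \<and>
    set ts \<subseteq> TVar ` X \<union> (\<lambda>(s, t). TJoin s t) ` (T \<times> T)}"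

lemma next_level_mono: "T \<subseteq> T' \<Longrightarrow> next_level X T \<subseteq> next_level X T'"
  unfolding next_level_def by (rule image_mono) blast

lemma next_level_terms_over:
  assumes "T \<subseteq> terms_over X" shows "next_level X T \<subseteq> terms_over X"
proof -
  have "TVar ` X \<union> (\<lambda>(s, t). TJoin s t) ` (T \<times> T) \<subseteq> terms_over X" using assms by auto
  then have "meet_list ts \<in> terms_over X"
    if "ts \<noteq> []" "set ts \<subseteq> TVar ` X \<union> (\<lambda>(s, t). TJoin s t) ` (T \<times> T)" for ts
    using that by (meson meet_list_terms_over order_trans)
  then show ?thesis unfolding next_level_def by (intro image_subsetI) simp
qed

lemma finite_next_level:
  assumes "finite X" "finite T" shows "finite (next_level X T)"
proof -
  let ?H = "TVar ` X \<union> (\<lambda>(s, t). TJoin s t) ` (T \<times> T)"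
  have fin: "finite ?H" using assms by simp
  have "{ts. ts \<noteq> [] \<and> distinct ts \<and> set ts \<subseteq> ?H} \<subseteq> {ts. set ts \<subseteq> ?H \<and> length ts \<le> card ?H}"
    by (auto simp: card_mono[OF fin] distinct_card[symmetric] simp del: Un_subset_iff)
  then show ?thesis
    unfolding next_level_def using finite_lists_length_le[OF fin] by (meson finite_imageI finite_subset)
qed

lemma join_mem_next_level: "s \<in> T \<Longrightarrow> t \<in> T \<Longrightarrow> TJoin s t \<in> next_level X T"
  unfolding next_level_def by (rule image_eqI[of _ _ "[TJoin s t]"]) auto

lemma eval_meet_list:
  fixes L :: "'a gorder" (structure)
  assumes L: "lattice L" and R: "lattice_filter L R" and "ts \<noteq> []"
    and "\<And>t. t \<in> set ts \<Longrightarrow> eval_term L e t \<in> carrier L \<and> R (eval_term L e t)"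
  shows "eval_term L e (meet_list ts) \<in> carrier L \<and> R (eval_term L e (meet_list ts)) \<and>
    (\<forall>t\<in>set ts. eval_term L e (meet_list ts) \<sqsubseteq> eval_term L e t)"
proof -
  interpret lattice L by fact
  show ?thesis using assms(3,4)
  proof (induction ts rule: meet_list.induct)
    case (2 t u ts)
    have IH: "eval_term L e (meet_list (u # ts)) \<in> carrier L" "R (eval_term L e (meet_list (u # ts)))"
      "\<forall>t\<in>set (u # ts). eval_term L e (meet_list (u # ts)) \<sqsubseteq> eval_term L e t"
      using 2 by auto
    have t: "eval_term L e t \<in> carrier L" "R (eval_term L e t)" using 2(3)[of t] by auto
    let ?m = "eval_term L e t \<sqinter> eval_term L e (meet_list (u # ts))"
    have "?m \<sqsubseteq> eval_term L e v" if "v \<in> set (u # ts)" for v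
      using meet_right[OF t(1) IH(1)] IH that 2(3)[of v] t(1)
      by (metis le_trans list.set_intros(2) meet_closed)
    moreover have "R ?m" using R t IH(1,2) unfolding lattice_filter_def by blast
    ultimately show ?case using meet_left[OF t(1) IH(1)] meet_closed[OF t(1) IH(1)] by simp
  qed auto
qed

text \<open>A splitting filter is determined by the generators and the joins of two members of \<open>S\<close> that
  it contains, hence is principal with one of finitely many least elements.\<close>

lemma splits_principal:
  fixes L :: "'a gorder" (structure)
  assumes L: "lattice L" and X: "finite X" and e: "e \<in> X \<rightarrow> carrier L"
    and gen: "sublattice_generated L (e ` X) = carrier L"
    and T: "finite T" "T \<subseteq> terms_over X"
    and R: "lattice_filter L R" "splits L (eval_term L e ` T) R"
    and v: "v \<in> carrier L" "R v"
  shows "\<exists>t\<in>next_level X T. eval_term L e t \<in> carrier L \<and> R (eval_term L e t) \<and>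
    (\<forall>u\<in>carrier L. R u \<longrightarrow> eval_term L e t \<sqsubseteq> u)"
proof -
  interpret lattice L by fact
  \<comment> \<open>The generators and joins of members of \<open>T\<close> whose values lie in the
    filter; their meet will be its least element.\<close>
  define H where "H = {t \<in> TVar ` X \<union> (\<lambda>(s, t). TJoin s t) ` (T \<times> T). R (eval_term L e t)}"
  have H: "finite H" "H \<subseteq> TVar ` X \<union> (\<lambda>(s, t). TJoin s t) ` (T \<times> T)"
    using X T unfolding H_def by auto
  have HX: "H \<subseteq> terms_over X" using H(2) T(2) by fastforce
  have HC: "eval_term L e t \<in> carrier L" if "t \<in> H" for t
    using eval_term_closed[OF L e] HX that by blast
  have sub: "R a" "R b" if "R (a \<sqinter> b)" "a \<in> carrier L" "b \<in> carrier L" for a b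
  proof -
    have "a \<sqinter> b \<in> carrier L" "a \<sqinter> b \<sqsubseteq> a" "a \<sqinter> b \<sqsubseteq> b"
      using that meet_left meet_right by auto
    then show "R a" "R b" using R(1) that unfolding lattice_filter_def by blast+
  qed
  \<comment> \<open>Induction over the generation of \<open>u\<close>. Nonemptiness of
    \<open>H\<close> is carried along because the meet of \<open>H\<close> must exist.\<close>
  have key: "H \<noteq> {} \<and> (\<forall>z\<in>carrier L. (\<forall>t\<in>H. z \<sqsubseteq> eval_term L e t) \<longrightarrow> z \<sqsubseteq> u)"
    if "u \<in> sublattice_generated L (e ` X)" "R u" for u
    using that
  proof induction
    case (gen u)
    then obtain x where "x \<in> X" "u = e x" by blast
    then have "TVar x \<in> H" using gen by (auto simp: H_def)
    then show ?case using \<open>u = e x\<close> by force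
  next
    case (join a b)
    have ab: "a \<in> carrier L" "b \<in> carrier L" using join(1,2) gen by auto
    note up = join_left[OF ab] join_right[OF ab]
    \<comment> \<open>Splitting either passes the filter to one joinand, where the induction
      hypothesis applies, or yields a smaller join whose term belongs to \<open>H\<close>.\<close>
    consider "R a" | "R b" | c d where "c \<in> eval_term L e ` T" "d \<in> eval_term L e ` T"
      "c \<sqsubseteq> a" "d \<sqsubseteq> b" "R (c \<squnion> d)"
      using R(2) join(5) ab unfolding splits_def by blast
    then show ?case
    proof cases
      case 1
      then show ?thesis using join(3) up ab by (meson join_closed le_trans)
    next
      case 2
      then show ?thesis using join(4) up ab by (meson join_closed le_trans)
    next
      case 3
      obtain s t where st: "s \<in> T" "t \<in> T" "c = eval_term L e s" "d = eval_term L e t"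
        using 3 by blast
      have cd: "c \<in> carrier L" "d \<in> carrier L" using st T(2) eval_term_closed[OF L e] by blast+
      have mem: "TJoin s t \<in> H" using st 3(5) by (auto simp: H_def)
      have "c \<squnion> d \<sqsubseteq> a \<squnion> b"
        using 3 cd ab up by (simp add: join_le_iff) (meson join_closed le_trans)
      moreover have "eval_term L e (TJoin s t) = c \<squnion> d" using st by simp
      ultimately have "z \<sqsubseteq> a \<squnion> b" if "z \<in> carrier L" "\<forall>t\<in>H. z \<sqsubseteq> eval_term L e t" for z
        using that mem cd ab by (metis join_closed le_trans)
      then show ?thesis using mem by blast
    qed
  next
    case (meet a b)
    have ab: "a \<in> carrier L" "b \<in> carrier L" using meet(1,2) gen by auto
    then show ?case using meet(3,4) sub[OF meet(5)] by (auto intro: meet_le)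
  qed
  have "H \<noteq> {}" using key[of v] v gen by simp
  then obtain ts where ts: "set ts = H" "distinct ts" "ts \<noteq> []"
    using finite_distinct_list[OF H(1)] by fastforce
  have "eval_term L e t \<in> carrier L \<and> R (eval_term L e t)" if "t \<in> set ts" for t
    using that HC ts(1) by (auto simp: H_def)
  note m = eval_meet_list[OF L R(1) ts(3) this]
  have "meet_list ts \<in> next_level X T"
    unfolding next_level_def using ts H(2) by auto
  moreover have "eval_term L e (meet_list ts) \<sqsubseteq> u" if "u \<in> carrier L" "R u" for u
    using key[of u] gen that m ts(1) by auto
  ultimately show ?thesis using m by blast
qed

text \<open>Levels consist of terms rather than elements, so that the same finite set can be
  evaluated in \<open>L\<close> and in the free lattice.\<close>

primrec level :: "nat \<Rightarrow> nat \<Rightarrow> nat lattice_term set" where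
  "level n 0 = {}"
| "level n (Suc k) = next_level {..<n} (level n k)"

lemma finite_level: "finite (level n k)"
  by (induction k) (auto simp: finite_next_level)

lemma level_terms_over: "level n k \<subseteq> terms_over {..<n}"
  by (induction k) (simp_all add: next_level_terms_over)

lemma level_mono: "k \<le> k' \<Longrightarrow> level n k \<subseteq> level n k'"
proof (rule lift_Suc_mono_le[of "level n"])
  show "level n k \<subseteq> level n (Suc k)" for k
    by (induction k) (simp_all add: next_level_mono)
qed

text \<open>The principal filter of \<open>p\<close> has \<open>p\<close> as its least element, and
  the least element of a filter splitting over level \<open>k\<close> is the value of a term of
  level \<open>k + 1\<close>.\<close>

lemma splits_level_generated:
  fixes L :: "'a gorder" (structure)
  assumes L: "lattice L" and e: "e \<in> {..<n} \<rightarrow> carrier L"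
    and gen: "sublattice_generated L (e ` {..<n}) = carrier L"
    and p: "p \<in> carrier L" "splits L (eval_term L e ` level n k) (\<lambda>c. p \<sqsubseteq> c)"
  shows "p \<in> eval_term L e ` level n (Suc k)"
proof -
  interpret lattice L by fact
  have "lattice_filter L (\<lambda>c. p \<sqsubseteq> c)"
    using p(1) by (auto simp: lattice_filter_def intro: le_trans meet_le)
  then obtain t where "t \<in> level n (Suc k)" "eval_term L e t \<in> carrier L" "p \<sqsubseteq> eval_term L e t"
    "eval_term L e t \<sqsubseteq> p"
    using splits_principal[OF L _ e gen finite_level level_terms_over _ p(2) p(1)] p(1)
    by fastforce
  then show ?thesis using p(1) by (metis image_eqI le_antisym)
qed

lemma sublattice_generated_mono:
  assumes "Y \<subseteq> Z" shows "sublattice_generated L Y \<subseteq> sublattice_generated L Z"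
proof
  fix u assume "u \<in> sublattice_generated L Y"
  then show "u \<in> sublattice_generated L Z"
    by induction (use assms in \<open>auto intro: sublattice_generated.intros\<close>)
qed

text \<open>Yields a least element without knowing that the doubly prime tuple generates
  \<open>L\<close>: the elements of a finite generating set \<open>Y\<close> and of \<open>S\<close>
  act as variables naming themselves.\<close>

lemma splits_least:
  fixes L :: "'a gorder" (structure)
  assumes L: "lattice L" "finitely_generated_lattice L"
    and S: "finite S" "S \<subseteq> carrier L"
    and R: "lattice_filter L R" "splits L S R"
    and v: "v \<in> carrier L" "R v"
  shows "\<exists>m\<in>carrier L. R m \<and> (\<forall>u\<in>carrier L. R u \<longrightarrow> m \<sqsubseteq> u)"
proof -
  obtain Y where Y: "finite Y" "Y \<subseteq> carrier L" "sublattice_generated L Y = carrier L"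
    using L(2) unfolding finitely_generated_lattice_def by blast
  have "sublattice_generated L ((\<lambda>x. x) ` (Y \<union> S)) = carrier L"
    using sublattice_generated_mono[of Y "Y \<union> S" L] Y S(2)
      sublattice_generated_closed[OF L(1), of "Y \<union> S"] by auto
  moreover have "eval_term L (\<lambda>x. x) ` TVar ` S = S" by (simp add: image_image)
  moreover have "(\<lambda>x. x) \<in> Y \<union> S \<rightarrow> carrier L" "finite (Y \<union> S)" "TVar ` S \<subseteq> terms_over (Y \<union> S)"
    using Y S by auto
  ultimately have "\<exists>t\<in>next_level (Y \<union> S) (TVar ` S). eval_term L (\<lambda>x. x) t \<in> carrier L \<and>
    R (eval_term L (\<lambda>x. x) t) \<and> (\<forall>u\<in>carrier L. R u \<longrightarrow> eval_term L (\<lambda>x. x) t \<sqsubseteq> u)"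
    using R v S(1) by (intro splits_principal[OF L(1), where v = v]) simp_all
  then show ?thesis by blast
qed

section \<open>Finitely generated projective lattices\<close>

lemma lattice_hom_le:
  assumes f: "f \<in> lattice_hom L M" and ab: "a \<in> carrier L" "b \<in> carrier L" "a \<sqsubseteq>\<^bsub>L\<^esub> b"
  shows "f a \<sqsubseteq>\<^bsub>M\<^esub> f b"
proof -
  interpret L: lattice L using f by (simp add: lattice_hom_def join_pres_def)
  interpret M: lattice M using f by (simp add: lattice_hom_def join_pres_def)
  have "f a \<squnion>\<^bsub>M\<^esub> f b = f b"
    using f ab(1,2) L.join_eq_right_iff[OF ab(1,2)] ab(3) by (simp add: lattice_hom_def join_pres_def) metis
  moreover have "f a \<in> carrier M" "f b \<in> carrier M" using f ab(1,2) by (auto simp: lattice_hom_def)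
  ultimately show ?thesis by (simp add: M.join_eq_right_iff)
qed

text \<open>Projectivity lifts the identity of \<open>L\<close> through the canonical surjection
  \<open>p\<close> from the free lattice. The lift \<open>g\<close> has \<open>p\<close> as a left
  inverse, and as both are monotone, \<open>g\<close> reflects the order.\<close>

lemma projective_lattice_free_embedding:
  fixes L :: "'a gorder" (structure)
  assumes L: "lattice L" "projective_lattice L"
  shows "\<exists>g\<in>lattice_hom L (free_lattice (carrier L)).
    \<forall>a\<in>carrier L. \<forall>b\<in>carrier L. g a \<sqsubseteq>\<^bsub>free_lattice (carrier L)\<^esub> g b \<longleftrightarrow> a \<sqsubseteq> b"
proof -
  let ?F = "free_lattice (carrier L)"
  obtain p where p: "p \<in> lattice_hom ?F L" "\<forall>x\<in>carrier L. p (free_gen (carrier L) x) = x"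
    using free_lattice_universal[OF L(1), of "\<lambda>x. x" "carrier L"] by auto
  have "p ` carrier ?F = carrier L"
  proof
    show "p ` carrier ?F \<subseteq> carrier L" using p(1) by (auto simp: lattice_hom_def)
    show "carrier L \<subseteq> p ` carrier ?F" using p(2) free_gen_carrier by (metis image_eqI subsetI)
  qed
  moreover have "(\<lambda>x. x) \<in> lattice_hom L L"
    using L(1) by (simp add: lattice_hom_def join_pres_def meet_pres_def)
  ultimately have "\<exists>g\<in>lattice_hom L ?F. \<forall>x\<in>carrier L. x = p (g x)"
    by (intro projective_lattice_lifting[OF L free_lattice_lattice L(1) p(1)])
  then obtain g where g: "g \<in> lattice_hom L ?F" "\<forall>x\<in>carrier L. x = p (g x)" by blast
  have "g a \<in> carrier ?F" if "a \<in> carrier L" for a using g(1) that by (auto simp: lattice_hom_def)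
  then show ?thesis using g lattice_hom_le[OF g(1)] lattice_hom_le[OF p(1)] by (metis (no_types, lifting))
qed

text \<open>By induction on the term \<open>w\<close> of the free lattice in which \<open>L\<close> is embedded by \<open>g\<close>, the filter
  \<open>{c. w \<sqsubseteq> g c}\<close> of \<open>L\<close> splits over some level: generators are join prime, meets are handled by
  Whitman's condition, and joins by the least elements of the filters of the two joinands.\<close>

lemma projective_lattice_covered_by_levels:
  fixes L :: "'a gorder" (structure)
  assumes L: "lattice L" "finitely_generated_lattice L" "projective_lattice L"
    and e: "e \<in> {..<n} \<rightarrow> carrier L"
    and closed: "\<And>k p. p \<in> carrier L \<Longrightarrow> splits L (eval_term L e ` level n k) (\<lambda>c. p \<sqsubseteq> c) \<Longrightarrow>
      p \<in> eval_term L e ` level n (Suc k)"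
    and a: "a \<in> carrier L"
  shows "\<exists>k. a \<in> eval_term L e ` level n k"
proof -
  let ?C = "carrier L"
  let ?F = "free_lattice ?C"
  let ?cl = "\<lambda>t. lattice_cong ?C `` {t}"
  interpret lattice L by fact
  interpret F: lattice ?F by (rule free_lattice_lattice)
  obtain g where g: "g \<in> lattice_hom L ?F"
    and g_le: "\<And>a b. a \<in> ?C \<Longrightarrow> b \<in> ?C \<Longrightarrow> g a \<sqsubseteq>\<^bsub>?F\<^esub> g b \<longleftrightarrow> a \<sqsubseteq> b"
    using projective_lattice_free_embedding[OF L(1,3)] by blast
  have gC: "g c \<in> carrier ?F" if "c \<in> ?C" for c using g that by (auto simp: lattice_hom_def)
  have gj: "g (c \<squnion> d) = g c \<squnion>\<^bsub>?F\<^esub> g d" if "c \<in> ?C" "d \<in> ?C" for c d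
    using g that by (simp add: lattice_hom_def join_pres_def)
  have gm: "g (c \<sqinter> d) = g c \<sqinter>\<^bsub>?F\<^esub> g d" if "c \<in> ?C" "d \<in> ?C" for c d
    using g that by (simp add: lattice_hom_def meet_pres_def)
  define S where "S k = eval_term L e ` level n k" for k
  have S: "finite (S k)" "S k \<subseteq> ?C" for k
    unfolding S_def by (simp add: finite_level)
      (use eval_term_closed[OF L(1) e] level_terms_over in blast)
  have S_mono: "k \<le> k' \<Longrightarrow> S k \<subseteq> S k'" for k k' unfolding S_def by (intro image_mono level_mono)
  have S_join: "c \<squnion> d \<in> S (Suc k)" if "c \<in> S k" "d \<in> S k" for c d k
  proof -
    obtain s t where "s \<in> level n k" "t \<in> level n k" "c = eval_term L e s" "d = eval_term L e t"
      using \<open>c \<in> S k\<close> \<open>d \<in> S k\<close> unfolding S_def by blast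
    then show ?thesis
      unfolding S_def by (intro image_eqI[of _ _ "TJoin s t"]) (auto intro: join_mem_next_level)
  qed
  \<comment> \<open>The trace on \<open>L\<close> of the principal filter of \<open>w\<close>; here
    \<open>w\<close> may lie outside the image of \<open>g\<close>.\<close>
  define R where "R w c \<longleftrightarrow> w \<sqsubseteq>\<^bsub>?F\<^esub> g c" for w c
  have R_up: "R w d" if "R w c" "c \<sqsubseteq> d" "w \<in> carrier ?F" "c \<in> ?C" "d \<in> ?C" for w c d
    using that gC g_le unfolding R_def by (meson F.le_trans)
  have R_filter: "lattice_filter L (R w)" if "w \<in> carrier ?F" for w
    using that R_up by (auto simp: lattice_filter_def) (auto simp: R_def gm gC intro: F.meet_le)
  \<comment> \<open>On \<open>L\<close> the filter of \<open>w\<close> is the principal filter of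
    its least element \<open>m\<close>, so the latter splits over \<open>S k\<close> too, and
    \<open>closed\<close> puts \<open>m\<close> into the next level.\<close>
  have least: "\<exists>u\<in>S (Suc k). u \<sqsubseteq> c \<and> R w u"
    if w: "w \<in> carrier ?F" "splits L (S k) (R w)" and c: "c \<in> ?C" "R w c" for w k c
  proof -
    obtain m where m: "m \<in> ?C" "R w m" "\<And>u. u \<in> ?C \<Longrightarrow> R w u \<Longrightarrow> m \<sqsubseteq> u"
      using splits_least[OF L(1,2) S R_filter[OF w(1)] w(2) c] by blast
    have "R w u \<longleftrightarrow> m \<sqsubseteq> u" if "u \<in> ?C" for u using m R_up w(1) that by blast
    then have "splits L (S k) (\<lambda>u. m \<sqsubseteq> u)"
      using splits_cong[OF L(1) S(2) w(2)] by blast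
    then have "m \<in> S (Suc k)" using closed[OF m(1)] by (simp add: S_def)
    then show ?thesis using m c by blast
  qed
  have common: "\<exists>k. splits L (S k) (R v) \<and> splits L (S k) (R w)"
    if v: "\<exists>k. splits L (S k) (R v)" and w: "\<exists>k. splits L (S k) (R w)" for v w
  proof -
    obtain i j where i: "splits L (S i) (R v)" and j: "splits L (S j) (R w)" using v w by blast
    have "splits L (S (max i j)) (R v)" by (rule splits_mono[OF i]) (simp add: S_mono)
    moreover have "splits L (S (max i j)) (R w)" by (rule splits_mono[OF j]) (simp add: S_mono)
    ultimately show ?thesis by blast
  qed
  have main: "\<exists>k. splits L (S k) (R (?cl t))" if "t \<in> terms_over ?C" for t
    using that
  proof (induction t)
    case (TVar x)
    then have "doubly_prime ?F (?cl (TVar x))"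
      using free_gen_doubly_prime[of x ?C] by (simp add: free_gen_def)
    then have "R (?cl (TVar x)) c \<or> R (?cl (TVar x)) d"
      if "c \<in> ?C" "d \<in> ?C" "R (?cl (TVar x)) (c \<squnion> d)" for c d
      using that gC[OF that(1)] gC[OF that(2)] unfolding doubly_prime_def R_def gj[OF that(1,2)] by blast
    \<comment> \<open>\<open>S 0\<close> is empty, so splitting over it is plain join
      primality.\<close>
    then have "splits L (S 0) (R (?cl (TVar x)))" unfolding splits_def by blast
    then show ?case ..
  next
    case (TMeet s t)
    then have st: "s \<in> terms_over ?C" "t \<in> terms_over ?C" by simp_all
    then have stC: "?cl s \<in> carrier ?F" "?cl t \<in> carrier ?F" "?cl (TMeet s t) \<in> carrier ?F"
      by (auto intro: free_class_carrier)
    obtain k where sp: "splits L (S k) (R (?cl s))" "splits L (S k) (R (?cl t))"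
      using common[OF TMeet.IH] st by blast
    have below: "?cl (TMeet s t) \<sqsubseteq>\<^bsub>?F\<^esub> ?cl s" "?cl (TMeet s t) \<sqsubseteq>\<^bsub>?F\<^esub> ?cl t"
      using free_meet_lower1[OF st] free_meet_lower1[OF st(2,1)] free_class_meet_comm[OF st] by auto
    have down: "R (?cl (TMeet s t)) c" if "R (?cl s) c \<or> R (?cl t) c" "c \<in> ?C" for c
      using that below stC gC unfolding R_def by (meson F.le_trans)
    have "splits L (S k) (R (?cl (TMeet s t)))"
      unfolding splits_def
    proof (intro ballI impI)
      fix c d assume cd: "c \<in> ?C" "d \<in> ?C" and Rcd: "R (?cl (TMeet s t)) (c \<squnion> d)"
      let ?goal = "R (?cl (TMeet s t)) c \<or> R (?cl (TMeet s t)) d \<or>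
        (\<exists>c'\<in>S k. \<exists>d'\<in>S k. c' \<sqsubseteq> c \<and> d' \<sqsubseteq> d \<and> R (?cl (TMeet s t)) (c' \<squnion> d'))"
      obtain u v where uv: "u \<in> terms_over ?C" "v \<in> terms_over ?C" "g c = ?cl u" "g d = ?cl v"
        using gC cd by (meson carrier_free_latticeE)
      have "whitman_le (TMeet s t) (TJoin u v)"
        using Rcd cd uv st by (simp add: R_def gj free_lattice_join free_le_iff_whitman)
      \<comment> \<open>Whitman's condition. In the last two cases the splitting for
        \<open>s\<close> or \<open>t\<close> refines the cover, and the refinement remains a cover
        of the smaller element, the meet.\<close>
      then have "R (?cl (TMeet s t)) c \<or> R (?cl (TMeet s t)) d \<or> R (?cl s) (c \<squnion> d) \<or> R (?cl t) (c \<squnion> d)"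
        using cd uv st
        by (auto simp: R_def gj free_lattice_join free_le_iff_whitman elim!: whitman_meet_joinE)
      moreover have ?goal if w: "w = s \<or> w = t" "R (?cl w) (c \<squnion> d)" for w
      proof -
        have "splits L (S k) (R (?cl w))" using w(1) sp by blast
        from this cd w(2) show ?goal
        proof (cases rule: splitsE)
          case (3 c' d')
          then have "c' \<squnion> d' \<in> ?C" using S(2) by (meson join_closed subsetD)
          then have "R (?cl (TMeet s t)) (c' \<squnion> d')" using down w(1) 3(5) by blast
          then show ?thesis using 3 by blast
        qed (use down w(1) cd in blast)+
      qed
      ultimately show ?goal by blast
    qed
    then show ?case ..
  next
    case (TJoin s t)
    then have st: "s \<in> terms_over ?C" "t \<in> terms_over ?C" by simp_all
    then have stC: "?cl s \<in> carrier ?F" "?cl t \<in> carrier ?F"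
      by (auto intro: free_class_carrier)
    have R_join: "R (?cl (TJoin s t)) c \<longleftrightarrow> R (?cl s) c \<and> R (?cl t) c" if "c \<in> ?C" for c
      using F.join_le_iff[OF stC gC[OF that]] st by (simp add: R_def free_lattice_join)
    obtain k where sp: "splits L (S k) (R (?cl s))" "splits L (S k) (R (?cl t))"
      using common[OF TJoin.IH] st by blast
    \<comment> \<open>One level is spent on least elements below \<open>c\<close> and
      \<open>d\<close>, the second on joining the refinements obtained for \<open>s\<close> and
      \<open>t\<close>.\<close>
    have "splits L (S (Suc (Suc k))) (R (?cl (TJoin s t)))"
      unfolding splits_def
    proof (intro ballI impI)
      fix c d assume cd: "c \<in> ?C" "d \<in> ?C" and Rcd: "R (?cl (TJoin s t)) (c \<squnion> d)"
      define Q where "Q w \<longleftrightarrow> (\<exists>c'\<in>S (Suc k). \<exists>d'\<in>S (Suc k). c' \<sqsubseteq> c \<and> d' \<sqsubseteq> d \<and> R w (c' \<squnion> d'))" for w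
      have three: "R w c \<or> R w d \<or> Q w" if "w = ?cl s \<or> w = ?cl t" for w
      proof -
        have R: "R w (c \<squnion> d)" and "splits L (S k) (R w)" using that Rcd R_join cd sp by auto
        then have "splits L (S (Suc k)) (R w)" using S_mono[of k "Suc k"] by (simp add: splits_mono)
        from this cd R show ?thesis
          by (cases rule: splitsE) (auto simp: Q_def)
      qed
      show "R (?cl (TJoin s t)) c \<or> R (?cl (TJoin s t)) d \<or> (\<exists>c'\<in>S (Suc (Suc k)).
        \<exists>d'\<in>S (Suc (Suc k)). c' \<sqsubseteq> c \<and> d' \<sqsubseteq> d \<and> R (?cl (TJoin s t)) (c' \<squnion> d'))"
      proof (intro disjCI)
        assume "\<not> (R (?cl (TJoin s t)) d \<or> (\<exists>c'\<in>S (Suc (Suc k)).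
          \<exists>d'\<in>S (Suc (Suc k)). c' \<sqsubseteq> c \<and> d' \<sqsubseteq> d \<and> R (?cl (TJoin s t)) (c' \<squnion> d')))"
        then have nd: "\<not> (R (?cl s) d \<and> R (?cl t) d)" and nS: "\<not> (\<exists>c'\<in>S (Suc (Suc k)).
          \<exists>d'\<in>S (Suc (Suc k)). c' \<sqsubseteq> c \<and> d' \<sqsubseteq> d \<and> R (?cl (TJoin s t)) (c' \<squnion> d'))"
          using R_join cd by blast+
        show "R (?cl (TJoin s t)) c"
        proof (rule ccontr)
          assume "\<not> R (?cl (TJoin s t)) c"
          then have nc: "\<not> (R (?cl s) c \<and> R (?cl t) c)" using R_join cd by blast
          note lc = least[OF stC(1) sp(1)] least[OF stC(2) sp(2)]
          \<comment> \<open>If \<open>c\<close> belongs to one of the two filters, use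
            \<open>least\<close>. Otherwise, by \<open>nd\<close>, one of them contains neither
            \<open>c\<close> nor \<open>d\<close>, and its refinement supplies a member below
            \<open>c\<close>. The argument for \<open>d\<close> is symmetric.\<close>
          have "\<exists>c0\<in>S (Suc k). c0 \<sqsubseteq> c" "\<exists>d0\<in>S (Suc k). d0 \<sqsubseteq> d"
            using three[of "?cl s"] three[of "?cl t"] nc nd lc cd unfolding Q_def by blast+
          then obtain c0 d0 where 0: "c0 \<in> S (Suc k)" "c0 \<sqsubseteq> c" "d0 \<in> S (Suc k)" "d0 \<sqsubseteq> d" by blast
          \<comment> \<open>If the filter of \<open>w\<close> contains \<open>c\<close>, its least
            element paired with \<open>d0\<close> is a refinement; if it contains \<open>d\<close>,
            pair its least element with \<open>c0\<close>.\<close>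
          have Q: "Q w" if w: "w = ?cl s \<or> w = ?cl t" for w
          proof -
            have wC: "w \<in> carrier ?F" using w stC by blast
            have "\<exists>u\<in>S (Suc k). u \<sqsubseteq> x \<and> R w u" if "R w x" "x \<in> ?C" for x
              using w lc that by blast
            moreover have "R w (x \<squnion> y)" if "R w x \<or> R w y" "x \<in> S (Suc k)" "y \<in> S (Suc k)" for x y
              using that S(2) wC R_up[of w x "x \<squnion> y"] R_up[of w y "x \<squnion> y"]
              by (meson join_closed join_left join_right subsetD)
            ultimately show ?thesis using three[OF w] 0 cd unfolding Q_def by meson
          qed
          obtain c1 d1 where 1: "c1 \<in> S (Suc k)" "d1 \<in> S (Suc k)" "c1 \<sqsubseteq> c" "d1 \<sqsubseteq> d"
            "R (?cl s) (c1 \<squnion> d1)" using Q[of "?cl s"] unfolding Q_def by blast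
          obtain c2 d2 where 2: "c2 \<in> S (Suc k)" "d2 \<in> S (Suc k)" "c2 \<sqsubseteq> c" "d2 \<sqsubseteq> d"
            "R (?cl t) (c2 \<squnion> d2)" using Q[of "?cl t"] unfolding Q_def by blast
          have C: "c1 \<in> ?C" "d1 \<in> ?C" "c2 \<in> ?C" "d2 \<in> ?C" using 1 2 S(2) by blast+
          \<comment> \<open>Joined componentwise, the two refinements cover both \<open>s\<close>
            and \<open>t\<close>; by \<open>S_join\<close> the components lie one level higher,
            contrary to \<open>nS\<close>.\<close>
          let ?j = "(c1 \<squnion> c2) \<squnion> (d1 \<squnion> d2)"
          have jC: "?j \<in> ?C" using C by simp
          have up: "c1 \<squnion> c2 \<sqsubseteq> ?j" "d1 \<squnion> d2 \<sqsubseteq> ?j" using C by (auto intro: join_left join_right)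
          then have "c1 \<sqsubseteq> ?j" "c2 \<sqsubseteq> ?j" "d1 \<sqsubseteq> ?j" "d2 \<sqsubseteq> ?j" using C jC by (simp_all add: join_le_iff)
          then have "c1 \<squnion> d1 \<sqsubseteq> ?j" "c2 \<squnion> d2 \<sqsubseteq> ?j" using C jC by (simp_all add: join_le_iff)
          then have "R (?cl (TJoin s t)) ?j"
            using 1 2 C jC stC R_up R_join by (meson join_closed)
          moreover have "c1 \<squnion> c2 \<sqsubseteq> c" "d1 \<squnion> d2 \<sqsubseteq> d" using 1 2 C cd by (simp_all add: join_le_iff)
          ultimately show False using nS S_join 1 2 by blast
        qed
      qed
    qed
    then show ?case ..
  qed
  \<comment> \<open>Taking \<open>w\<close> to be \<open>g a\<close> gives the principal filter of
    \<open>a\<close>, since \<open>g\<close> reflects the order; its least element \<open>a\<close>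
    thus lies in a level.\<close>
  obtain t where t: "t \<in> terms_over ?C" "g a = ?cl t" using gC a by (meson carrier_free_latticeE)
  then obtain k where k: "splits L (S k) (R (g a))" using main by metis
  have "R (g a) a" using a gC by (simp add: R_def)
  then obtain u where u: "u \<in> S (Suc k)" "u \<sqsubseteq> a" "R (g a) u" using least[OF gC[OF a] k a] by blast
  then have "u = a" using a S(2) g_le unfolding R_def by (meson le_antisym subsetD)
  then show ?thesis using u(1) unfolding S_def by blast
qed

section \<open>First-order transfer\<close>

lemma finite_free_vars: "finite (free_vars \<phi>)"
proof -
  have "finite (term_vars t)" for t :: "nat lattice_term" by (induction t) auto
  then show ?thesis by (induction \<phi>) auto
qed

lemma models_FAll: "models L (FAll k \<phi>) \<longleftrightarrow> models L \<phi>"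
proof
  assume l: "models L (FAll k \<phi>)"
  show "models L \<phi>"
    unfolding models_def
  proof (intro allI impI)
    fix e :: "nat \<Rightarrow> 'a" assume e: "range e \<subseteq> carrier L"
    then have "satisfies L (e(k := e k)) \<phi>"
      using l unfolding models_def by (metis rangeI satisfies.simps(4) subsetD)
    then show "satisfies L e \<phi>" by simp
  qed
next
  assume r: "models L \<phi>"
  have "range (e(k := a)) \<subseteq> carrier L" if "range e \<subseteq> carrier L" "a \<in> carrier L" for e :: "nat \<Rightarrow> 'a" and a
    using that by auto
  then show "models L (FAll k \<phi>)" using r by (simp add: models_def)
qed

text \<open>A formula holds under all assignments exactly if its universal closure does, so the
  equivalence extends from sentences to formulas with free variables.\<close>

lemma elementarily_equivalent_models:
  assumes "elementarily_equivalent L M" shows "models L \<phi> \<longleftrightarrow> models M \<phi>"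
proof -
  obtain ks where ks: "set ks = free_vars \<phi>" using finite_list[OF finite_free_vars] by blast
  have "free_vars (foldr FAll ks \<phi>) = free_vars \<phi> - set ks" for ks by (induction ks) auto
  then have "free_vars (foldr FAll ks \<phi>) = {}" using ks by simp
  moreover have "models L (foldr FAll ks \<phi>) \<longleftrightarrow> models L \<phi>" "models M (foldr FAll ks \<phi>) \<longleftrightarrow> models M \<phi>"
    for ks by (induction ks) (simp_all add: models_FAll)
  ultimately show ?thesis using assms unfolding elementarily_equivalent_def by blast
qed

section \<open>Formulas for doubly prime tuples and for splitting\<close>

definition FImp :: "lattice_formula \<Rightarrow> lattice_formula \<Rightarrow> lattice_formula" where
  "FImp \<phi> \<psi> = FNeg (FConj \<phi> (FNeg \<psi>))"

definition FLe :: "nat lattice_term \<Rightarrow> nat lattice_term \<Rightarrow> lattice_formula" where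
  "FLe s t = FEq (TJoin s t) t"

text \<open>A trivial equation serves as the empty conjunction, the language having no truth
  constants.\<close>

primrec FConjs :: "lattice_formula list \<Rightarrow> lattice_formula" where
  "FConjs [] = FEq (TVar 0) (TVar 0)"
| "FConjs (\<phi> # \<phi>s) = FConj \<phi> (FConjs \<phi>s)"

definition FDisjs :: "lattice_formula list \<Rightarrow> lattice_formula" where
  "FDisjs \<phi>s = FNeg (FConjs (map FNeg \<phi>s))"

lemma satisfies_FImp [simp]:
  "satisfies L e (FImp \<phi> \<psi>) \<longleftrightarrow> (satisfies L e \<phi> \<longrightarrow> satisfies L e \<psi>)"
  by (simp add: FImp_def)

lemma satisfies_FConjs [simp]: "satisfies L e (FConjs \<phi>s) \<longleftrightarrow> (\<forall>\<phi>\<in>set \<phi>s. satisfies L e \<phi>)"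
  by (induction \<phi>s) auto

lemma satisfies_FDisjs [simp]: "satisfies L e (FDisjs \<phi>s) \<longleftrightarrow> (\<exists>\<phi>\<in>set \<phi>s. satisfies L e \<phi>)"
  by (simp add: FDisjs_def)

lemma satisfies_FLe [simp]:
  assumes "lattice L" "range e \<subseteq> carrier L"
  shows "satisfies L e (FLe s t) \<longleftrightarrow> eval_term L e s \<sqsubseteq>\<^bsub>L\<^esub> eval_term L e t"
proof -
  have "eval_term L e u \<in> carrier L" for u
    using eval_term_closed[OF assms(1), of e UNIV u] assms(2) by (auto simp: terms_over_def)
  then show ?thesis by (simp add: FLe_def lattice.join_eq_right_iff[OF assms(1)])
qed

text \<open>The variables below \<open>n\<close> are reserved for the tuple of doubly prime elements.\<close>

definition doubly_prime_formula :: "nat \<Rightarrow> nat \<Rightarrow> lattice_formula" where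
  "doubly_prime_formula n i =
    (let x = TVar i; a = TVar n; b = TVar (Suc n) in
      FAll n (FAll (Suc n) (FConj
        (FImp (FLe x (TJoin a b)) (FDisjs [FLe x a, FLe x b]))
        (FImp (FLe (TMeet a b) x) (FDisjs [FLe a x, FLe b x])))))"

lemma satisfies_doubly_prime_formula:
  assumes "lattice L" "range e \<subseteq> carrier L" "i < n"
  shows "satisfies L e (doubly_prime_formula n i) \<longleftrightarrow> doubly_prime L (e i)"
proof -
  have "range (e(n := a, Suc n := b)) \<subseteq> carrier L" if "a \<in> carrier L" "b \<in> carrier L" for a b
    using that assms(2) by auto
  then show ?thesis
    using assms(1,3) by (simp add: doubly_prime_formula_def doubly_prime_def Let_def)
qed

definition doubly_prime_tuple_formula :: "nat \<Rightarrow> lattice_formula" where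
  "doubly_prime_tuple_formula n = FConj
    (FConjs [FNeg (FEq (TVar i) (TVar j)). i \<leftarrow> [0..<n], j \<leftarrow> [0..<n], i \<noteq> j])
    (FConjs [doubly_prime_formula n i. i \<leftarrow> [0..<n]])"

lemma satisfies_doubly_prime_tuple_formula:
  assumes "lattice L" "range e \<subseteq> carrier L"
  shows "satisfies L e (doubly_prime_tuple_formula n) \<longleftrightarrow> doubly_prime_tuple L n e"
proof -
  have "inj_on e {..<n} \<longleftrightarrow> (\<forall>i<n. \<forall>j<n. i \<noteq> j \<longrightarrow> e i \<noteq> e j)"
    unfolding inj_on_def by blast
  moreover have "satisfies L e (FConjs [FNeg (FEq (TVar i) (TVar j)). i \<leftarrow> [0..<n], j \<leftarrow> [0..<n], i \<noteq> j])
      \<longleftrightarrow> (\<forall>i<n. \<forall>j<n. i \<noteq> j \<longrightarrow> e i \<noteq> e j)"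
    by simp force
  moreover have "satisfies L e (FConjs [doubly_prime_formula n i. i \<leftarrow> [0..<n]]) \<longleftrightarrow>
      (\<forall>i<n. doubly_prime L (e i))"
    using satisfies_doubly_prime_formula[OF assms] by auto
  ultimately show ?thesis
    unfolding doubly_prime_tuple_formula_def doubly_prime_tuple_def satisfies.simps by blast
qed

text \<open>The variable \<open>n\<close> stands for \<open>p\<close>.\<close>

definition splits_formula :: "nat \<Rightarrow> nat lattice_term list \<Rightarrow> lattice_formula" where
  "splits_formula n ts =
    (let p = TVar n; c = TVar (Suc n); d = TVar (Suc (Suc n)) in
      FAll (Suc n) (FAll (Suc (Suc n)) (FImp (FLe p (TJoin c d)) (FDisjs [FLe p c, FLe p d,
        FDisjs [FConjs [FLe s c, FLe t d, FLe p (TJoin s t)]. s \<leftarrow> ts, t \<leftarrow> ts]]))))"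

lemma eval_term_upd:
  fixes n :: nat
  shows "t \<in> terms_over {..<n} \<Longrightarrow> n \<le> k \<Longrightarrow> eval_term L (e(k := a)) t = eval_term L e t"
  by (induction t) auto

lemma satisfies_splits_formula:
  assumes "lattice L" "range e \<subseteq> carrier L" "set ts \<subseteq> terms_over {..<n}"
  shows "satisfies L e (splits_formula n ts) \<longleftrightarrow>
    splits L (eval_term L e ` set ts) (\<lambda>c. e n \<sqsubseteq>\<^bsub>L\<^esub> c)"
proof -
  have 1: "range (e(Suc n := a, Suc (Suc n) := b)) \<subseteq> carrier L"
    if "a \<in> carrier L" "b \<in> carrier L" for a b
    using that assms(2) by auto
  have 2: "eval_term L (e(Suc n := a, Suc (Suc n) := b)) t = eval_term L e t"
    if "t \<in> set ts" for a b t
    using that assms(3) by (simp add: eval_term_upd[of _ n] subset_eq)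
  show ?thesis
    using 1 assms(1) by (simp add: splits_formula_def splits_def Let_def 2)
qed

text \<open>With the tuple condition as the premise of an implication, truth under all assignments
  transfers. It thus suffices to check \<open>\<phi>\<close> in \<open>M\<close> at every doubly
  prime tuple.\<close>

lemma elementarily_equivalent_transfer:
  fixes L :: "'a gorder" and M :: "'b gorder"
  assumes eq: "elementarily_equivalent L M" and L: "lattice L" and M: "lattice M"
    and e: "range e \<subseteq> carrier L" "doubly_prime_tuple L n e"
    and \<phi>: "\<And>e. range e \<subseteq> carrier M \<Longrightarrow> doubly_prime_tuple M n e \<Longrightarrow> satisfies M e \<phi>"
  shows "satisfies L e \<phi>"
proof -
  have "models M (FImp (doubly_prime_tuple_formula n) \<phi>)"
    using \<phi> M by (simp add: models_def satisfies_doubly_prime_tuple_formula)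
  then have "models L (FImp (doubly_prime_tuple_formula n) \<phi>)"
    using elementarily_equivalent_models[OF eq] by blast
  then show ?thesis
    using e L by (simp add: models_def satisfies_doubly_prime_tuple_formula)
qed

text \<open>As \<open>models\<close> concerns all assignments, existence of a tuple is transferred
  as failure of the negated formula.\<close>

lemma elementarily_equivalent_free_lattice_tuple:
  fixes L :: "'a gorder"
  assumes eq: "elementarily_equivalent L (free_lattice_on n)" and L: "lattice L" and n: "0 < n"
  shows "\<exists>e. range e \<subseteq> carrier L \<and> doubly_prime_tuple L n e"
proof (rule ccontr)
  let ?F = "free_lattice_on n"
  assume "\<not> ?thesis"
  then have "models L (FNeg (doubly_prime_tuple_formula n))"
    using L by (simp add: models_def satisfies_doubly_prime_tuple_formula)
  then have m: "models ?F (FNeg (doubly_prime_tuple_formula n))"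
    using elementarily_equivalent_models[OF eq] by blast
  \<comment> \<open>Every variable needs a value in the carrier; beyond the tuple generator 0 is
    repeated, which exists since \<open>n\<close> is positive.\<close>
  define e where "e i = free_gen {..<n} (if i < n then i else 0)" for i
  have "range e \<subseteq> carrier ?F" using n by (auto simp: e_def intro!: free_gen_carrier)
  moreover have "doubly_prime_tuple ?F n e"
    using free_lattice_doubly_prime_tuple[of n] by (simp add: doubly_prime_tuple_def e_def inj_on_def)
  ultimately show False
    using m free_lattice_lattice
    unfolding models_def by (metis satisfies.simps(2) satisfies_doubly_prime_tuple_formula)
qed

text \<open>Both levels are finite, so the implication is a single formula, with \<open>p\<close>
  assigned to the variable \<open>n\<close>. In the free lattice it holds by
  \<open>splits_level_generated\<close>, because there every doubly prime tuple generates.\<close>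

lemma elementarily_equivalent_free_lattice_level:
  fixes L :: "'a gorder"
  assumes eq: "elementarily_equivalent L (free_lattice_on n)" and L: "lattice L"
    and e: "range e \<subseteq> carrier L" "doubly_prime_tuple L n e"
    and p: "p \<in> carrier L" "splits L (eval_term L e ` level n k) (\<lambda>c. p \<sqsubseteq>\<^bsub>L\<^esub> c)"
  shows "p \<in> eval_term L e ` level n (Suc k)"
proof -
  let ?F = "free_lattice_on n"
  obtain ts us where ts: "set ts = level n k" and us: "set us = level n (Suc k)"
    using finite_list[OF finite_level] by metis
  have over: "set ts \<subseteq> terms_over {..<n}" using ts level_terms_over by simp
  define \<phi> where "\<phi> = FImp (splits_formula n ts) (FDisjs [FEq (TVar n) t. t \<leftarrow> us])"
  have \<phi>: "satisfies M e \<phi> \<longleftrightarrow> (splits M (eval_term M e ` level n k) (\<lambda>c. e n \<sqsubseteq>\<^bsub>M\<^esub> c) \<longrightarrow>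
      e n \<in> eval_term M e ` level n (Suc k))"
    if "lattice M" "range e \<subseteq> carrier M" for M :: "'m gorder" and e
    using satisfies_splits_formula[OF that over] ts us by (auto simp: \<phi>_def image_iff simp del: level.simps)
  have "satisfies L (e(n := p)) \<phi>"
  proof (rule elementarily_equivalent_transfer[OF eq L free_lattice_lattice])
    show "range (e(n := p)) \<subseteq> carrier L" using e(1) p(1) by auto
    show "doubly_prime_tuple L n (e(n := p))"
      using e(2) by (simp add: doubly_prime_tuple_def inj_on_def)
    fix e :: "nat \<Rightarrow> nat lattice_term set"
    assume e: "range e \<subseteq> carrier ?F" "doubly_prime_tuple ?F n e"
    then have e_fun: "e \<in> {..<n} \<rightarrow> carrier ?F" by auto
    have "sublattice_generated ?F (e ` {..<n}) = carrier ?F"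
      using doubly_prime_tuple_free_lattice[OF e(2) e_fun] free_lattice_generated[of "{..<n}"] by simp
    then show "satisfies ?F e \<phi>"
      using splits_level_generated[OF free_lattice_lattice e_fun] e(1)
      by (simp add: \<phi>[OF free_lattice_lattice e(1)] range_subsetD del: level.simps)
  qed
  moreover have "range (e(n := p)) \<subseteq> carrier L" using e(1) p(1) by auto
  moreover have "eval_term L (e(n := p)) ` level n j = eval_term L e ` level n j" for j
    using level_terms_over by (intro image_cong refl eval_term_upd[of _ n]) auto
  ultimately show ?thesis using p(2) by (simp add: \<phi>[OF L] del: level.simps)
qed

text \<open>For terms that are not congruent, the negated equation holds at every doubly prime tuple
  of the free lattice and is transferred to \<open>L\<close>.\<close>

lemma elementarily_equivalent_free_lattice_eval_inj:
  fixes L :: "'a gorder"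
  assumes eq: "elementarily_equivalent L (free_lattice_on n)" and L: "lattice L"
    and e: "range e \<subseteq> carrier L" "doubly_prime_tuple L n e"
    and st: "s \<in> terms_over {..<n}" "t \<in> terms_over {..<n}" "eval_term L e s = eval_term L e t"
  shows "(s, t) \<in> lattice_cong {..<n}"
proof (rule ccontr)
  assume ncong: "(s, t) \<notin> lattice_cong {..<n}"
  have "satisfies L e (FNeg (FEq s t))"
  proof (rule elementarily_equivalent_transfer[OF eq L free_lattice_lattice e])
    fix e :: "nat \<Rightarrow> nat lattice_term set"
    assume e: "range e \<subseteq> carrier (free_lattice_on n)" "doubly_prime_tuple (free_lattice_on n) n e"
    then have "e \<in> {..<n} \<rightarrow> carrier (free_lattice_on n)" by auto
    then show "satisfies (free_lattice_on n) e (FNeg (FEq s t))"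
      using doubly_prime_tuple_eval_inj[OF e(2) _ st(1,2)] ncong by auto
  qed
  then show False using st(3) by simp
qed

text \<open>The universal property produces the map out of the free lattice, whereas the theorem
  asks for one into it.\<close>

lemma lattice_isomorphic_sym:
  assumes "lattice_isomorphic L M" shows "lattice_isomorphic M L"
proof -
  obtain f where f: "f \<in> lattice_hom L M" "bij_betw f (carrier L) (carrier M)"
    using assms by (auto simp: lattice_isomorphic_def)
  define g where "g = the_inv_into (carrier L) f"
  interpret L: lattice L using f(1) by (simp add: lattice_hom_def join_pres_def)
  interpret M: lattice M using f(1) by (simp add: lattice_hom_def join_pres_def)
  have g: "bij_betw g (carrier M) (carrier L)"
    unfolding g_def by (rule bij_betw_the_inv_into[OF f(2)])
  then have gC: "g y \<in> carrier L" if "y \<in> carrier M" for y using that by (auto simp: bij_betw_def)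
  have fg: "f (g y) = y" if "y \<in> carrier M" for y
    unfolding g_def using f(2) that by (auto simp: bij_betw_def intro: f_the_inv_into_f)
  have inj: "inj_on f (carrier L)" using f(2) by (simp add: bij_betw_def)
  have "g (x \<squnion>\<^bsub>M\<^esub> y) = g x \<squnion>\<^bsub>L\<^esub> g y" if "x \<in> carrier M" "y \<in> carrier M" for x y
    using that f(1) by (intro inj_onD[OF inj]) (simp_all add: gC fg lattice_hom_def join_pres_def)
  moreover have "g (x \<sqinter>\<^bsub>M\<^esub> y) = g x \<sqinter>\<^bsub>L\<^esub> g y" if "x \<in> carrier M" "y \<in> carrier M" for x y
    using that f(1) by (intro inj_onD[OF inj]) (simp_all add: gC fg lattice_hom_def meet_pres_def)
  ultimately have "g \<in> lattice_hom M L"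
    using gC by (simp add: lattice_hom_def join_pres_def meet_pres_def L.lattice_axioms M.lattice_axioms)
  then show ?thesis using g by (auto simp: lattice_isomorphic_def)
qed

theorem theorem1p5:
  fixes L :: "'a gorder" and n :: nat
  assumes "lattice L"
    and "finitely_generated_lattice L"
    and "projective_lattice L"
    and "3 \<le> n"
    and "elementarily_equivalent L (free_lattice_on n)"
  shows "lattice_isomorphic L (free_lattice_on n)"
proof -
  let ?F = "free_lattice_on n"
  obtain e where e: "range e \<subseteq> carrier L" "doubly_prime_tuple L n e"
    using elementarily_equivalent_free_lattice_tuple[OF assms(5,1)] assms(4) by auto
  have e_fun: "e \<in> {..<n} \<rightarrow> carrier L" using e(1) by auto
  obtain f where f: "f \<in> lattice_hom ?F L" "\<forall>i\<in>{..<n}. f (free_gen {..<n} i) = e i"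
    using free_lattice_universal[OF assms(1) e_fun] by blast
  \<comment> \<open>The image of \<open>f\<close> consists of the values of terms at
    \<open>e\<close>: injectivity becomes separation of terms, surjectivity becomes generation by
    the tuple.\<close>
  have f_eval: "f (free_class {..<n} t) = eval_term L e t" if "t \<in> terms_over {..<n}" for t
  proof -
    have "eval_term L (\<lambda>i. f (free_gen {..<n} i)) t = eval_term L e t"
      using that by (induction t) (simp_all add: f(2))
    then show ?thesis
      using hom_eval_term[OF f(1) _ that, of "free_gen {..<n}"] that
      by (simp add: eval_free_gen free_gen_carrier)
  qed
  have "inj_on f (carrier ?F)"
  proof (rule inj_onI)
    fix A B assume AB: "A \<in> carrier ?F" "B \<in> carrier ?F" "f A = f B"
    obtain s where s: "s \<in> terms_over {..<n}" "A = free_class {..<n} s"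
      using AB(1) by (rule carrier_free_latticeE)
    obtain t where t: "t \<in> terms_over {..<n}" "B = free_class {..<n} t"
      using AB(2) by (rule carrier_free_latticeE)
    have "eval_term L e s = eval_term L e t" using AB(3) s t by (simp add: f_eval)
    then have "(s, t) \<in> lattice_cong {..<n}"
      by (rule elementarily_equivalent_free_lattice_eval_inj[OF assms(5,1) e s(1) t(1)])
    then show "A = B" using s t by (simp add: free_class_eq_iff)
  qed
  moreover have "f ` carrier ?F = carrier L"
  proof
    show "f ` carrier ?F \<subseteq> carrier L" using f(1) by (auto simp: lattice_hom_def)
    show "carrier L \<subseteq> f ` carrier ?F"
    proof
      fix a assume "a \<in> carrier L"
      \<comment> \<open>Finite generation and projectivity of \<open>L\<close> enter here, with the
        transferred level property as the closure assumption.\<close>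
      then obtain k where "a \<in> eval_term L e ` level n k"
        using projective_lattice_covered_by_levels[OF assms(1-3) e_fun
            elementarily_equivalent_free_lattice_level[OF assms(5,1) e]] by blast
      then obtain t where t: "t \<in> terms_over {..<n}" "a = eval_term L e t"
        using level_terms_over by blast
      then show "a \<in> f ` carrier ?F"
        using f_eval[OF t(1)] free_class_carrier[OF t(1)] by (metis image_eqI)
    qed
  qed
  ultimately have "lattice_isomorphic ?F L"
    using f(1) by (auto simp: lattice_isomorphic_def bij_betw_def)
  then show ?thesis by (rule lattice_isomorphic_sym)
qed

end
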